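(* Let $\beta>0$, let $g'$ be bounded on $[0,T_\beta+1]$, and let $U$ be an open subset of $D(0,T_\beta)$ satisfying the following exterior ball condition: there exists $\epsilon>0$ such that for every $z\in\partial U$ there exists $\eta\in U^c$ with $B(\eta,\epsilon)\subset U^c$ and $|z-\eta|=\epsilon$. Then $$\lim_{n\to\infty}\frac1{n^2}\log\mathbf P\big[\mathcal X_{n,\beta}^{(g)}(U)=0\big]=-\frac\beta2\left[R_{U,\beta}^{(g)}-R_{\emptyset,\beta}^{(g)}\right].$$
   Context: $D(0,t)$ is the disk of radius $t$ centred at $0$; $B(\eta,\epsilon)$ is the ball of radius $\epsilon$ centred at $\eta$; $U^c=\mathbb C\setminus U$; $\emptyset$ is the empty set. The function $g:[0,\infty)\to[0,\infty)$ satisfies: (a) $g$ is increasing and $re^{-g(r)/2}\to0$ as $r\to\infty$; (b) $g$ is twice differentiable on $(0,\infty)$; (c) $\lim_{r\to0^+}rg'(r)=0$ and $rg'(r)$ is increasing on $(0,\infty)$; (d) $\int_0^\infty r^{2k+1}e^{-g(r)}dr<\infty$ for all $k=0,1,2,\dots$. $T_\beta>0$ denotes the solution of $tg'(t)=\beta$. At $0$, $g'$ is understood as a one-sided derivative. $\mathcal X_{n,\beta}^{(g)}$ is the point process of $n$ points in $\mathbb C$ whose joint density (in uniform random order) with respect to Lebesgue measure on $\mathbb C^n$ is $\frac1{Z_{n,\beta}^{(g)}}\prod_{i<j}|z_i-z_j|^\beta e^{-n\sum_{k=1}^ng(|z_k|)}$, with $Z_{n,\beta}^{(g)}$ the normalizing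 constant. $\mathcal X_{n,\beta}^{(g)}(\Omega)$ is the number of its points in $\Omega$. $\mathcal P(E)$ is the set of compactly supported probability measures with support in $E$; $R_{\mu,\beta}^{(g)}=\iint\log\frac1{|z-w|}d\mu(z)d\mu(w)+\frac2\beta\int g(|z|)d\mu(z)$; $R_{U,\beta}^{(g)}=\inf\{R_{\mu,\beta}^{(g)}:\mu\in\mathcal P(U^c)\}$. *)

theory Defs
  imports "HOL-Probability.Probability"
begin

section \<open>The potential\<close>

text \<open>
  A function on the half-line is modelled by a total function on the reals of which only the
  values on \<open>{0..}\<close> matter; \<open>deriv g\<close> is only used at positive arguments, where it depends on
  these values only. ``Increasing'' is read in the weak sense.
\<close>

definition admissible_potential :: "(real \<Rightarrow> real) \<Rightarrow> bool" where
  "admissible_potential g \<longleftrightarrow>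
     (\<forall>r\<ge>0. g r \<ge> 0) \<and>
     mono_on {0..} g \<and>
     ((\<lambda>r. r * exp (- g r / 2)) \<longlongrightarrow> 0) at_top \<and>
     g differentiable_on {0<..} \<and>
     deriv g differentiable_on {0<..} \<and>
     ((\<lambda>r. r * deriv g r) \<longlongrightarrow> 0) (at_right 0) \<and>
     mono_on {0<..} (\<lambda>r. r * deriv g r) \<and>
     (\<forall>k::nat. set_integrable lborel {0..} (\<lambda>r. r ^ (2 * k + 1) * exp (- g r)))"


section \<open>The point process\<close>

text \<open>
  The points are labelled by \<open>{..<n}\<close>. As the density is symmetric, the labelling given by the
  joint density is the uniformly random one.
\<close>

definition gas_weight :: "(real \<Rightarrow> real) \<Rightarrow> real \<Rightarrow> nat \<Rightarrow> (nat \<Rightarrow> complex) \<Rightarrow> real" where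
  "gas_weight g \<beta> n z =
     (\<Prod>j<n. \<Prod>i<j. cmod (z i - z j) powr \<beta>) * exp (- real n * (\<Sum>k<n. g (cmod (z k))))"

definition gas_partition_function :: "(real \<Rightarrow> real) \<Rightarrow> real \<Rightarrow> nat \<Rightarrow> ennreal" where
  "gas_partition_function g \<beta> n =
     (\<integral>\<^sup>+z. ennreal (gas_weight g \<beta> n z) \<partial>(\<Pi>\<^sub>M k\<in>{..<n}. lborel))"

definition gas_law :: "(real \<Rightarrow> real) \<Rightarrow> real \<Rightarrow> nat \<Rightarrow> (nat \<Rightarrow> complex) measure" where
  "gas_law g \<beta> n =
     density (\<Pi>\<^sub>M k\<in>{..<n}. lborel)
       (\<lambda>z. ennreal (gas_weight g \<beta> n z) / gas_partition_function g \<beta> n)"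

definition num_points :: "nat \<Rightarrow> (nat \<Rightarrow> complex) \<Rightarrow> complex set \<Rightarrow> nat" where
  "num_points n z \<Omega> = card {k. k < n \<and> z k \<in> \<Omega>}"


section \<open>The weighted logarithmic energy\<close>

text \<open>
  The integral of an extended real function as the integral of its positive part minus that of
  its negative part; \<open>e2ennreal\<close> truncates negative values to 0. The negative part has finite
  integral in the only use below, where the kernel is bounded below on the support.
\<close>

definition ereal_integral :: "'a measure \<Rightarrow> ('a \<Rightarrow> ereal) \<Rightarrow> ereal" where
  "ereal_integral M f =
     enn2ereal (\<integral>\<^sup>+x. e2ennreal (f x) \<partial>M) - enn2ereal (\<integral>\<^sup>+x. e2ennreal (- f x) \<partial>M)"

text \<open>The case distinction is needed because \<open>ln 0 = 0\<close>.\<close>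

definition log_kernel :: "complex \<Rightarrow> complex \<Rightarrow> ereal" where
  "log_kernel z w = (if z = w then \<infinity> else ereal (ln (1 / cmod (z - w))))"

definition measure_support :: "complex measure \<Rightarrow> complex set" where
  "measure_support \<mu> = {z. \<forall>e>0. emeasure \<mu> (ball z e) > 0}"

definition compact_prob_measures :: "complex set \<Rightarrow> complex measure set" where
  "compact_prob_measures E =
     {\<mu>. prob_space \<mu> \<and> sets \<mu> = sets borel \<and>
         compact (measure_support \<mu>) \<and> measure_support \<mu> \<subseteq> E}"

definition energy :: "(real \<Rightarrow> real) \<Rightarrow> real \<Rightarrow> complex measure \<Rightarrow> ereal" where
  "energy g \<beta> \<mu> =
     ereal_integral (\<mu> \<Otimes>\<^sub>M \<mu>) (\<lambda>(z, w). log_kernel z w) +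
     ereal (2 / \<beta> * (\<integral>z. g (cmod z) \<partial>\<mu>))"

definition min_energy :: "(real \<Rightarrow> real) \<Rightarrow> real \<Rightarrow> complex set \<Rightarrow> ereal" where
  "min_energy g \<beta> U = (INF \<mu>\<in>compact_prob_measures (- U). energy g \<beta> \<mu>)"


section \<open>The exterior ball condition\<close>

definition exterior_ball_condition :: "complex set \<Rightarrow> bool" where
  "exterior_ball_condition U \<longleftrightarrow>
     (\<exists>\<epsilon>>0. \<forall>z\<in>frontier U. \<exists>\<eta>\<in>- U. ball \<eta> \<epsilon> \<subseteq> - U \<and> cmod (z - \<eta>) = \<epsilon>)"

end

theory Submission
  imports Defs
begin

text \<open>
  Let \<open>Z\<^sub>U(n)\<close> be the integral of the weight over the configurations of \<open>n\<close> points that avoid \<open>U\<close>.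
  The hole probability is \<open>Z\<^sub>U(n) / Z\<^sub>\<emptyset>(n)\<close>, and the empty set satisfies the hypotheses on \<open>U\<close>.
  It therefore suffices to prove \<open>ln Z\<^sub>U(n) / n\<^sup>2 \<longlonglongrightarrow> - \<beta> / 2 * R\<close>, where \<open>R\<close> is the minimal energy
  over measures supported outside \<open>U\<close>.

  Both halves rest on one estimate for fixed configurations (\<open>smearing\<close>). The weight of a
  configuration of distinct points is \<open>exp (- Q)\<close>, where \<open>Q\<close> consists of \<open>\<beta>\<close> times the logarithmic
  interaction and \<open>n\<close> times the total potential. If the points lie outside \<open>U\<close>, each of them is
  replaced by the uniform distribution on a disc of a small radius \<open>\<delta>\<close> that lies outside \<open>U\<close> and
  whose centre is at distance at most \<open>2 * \<delta>\<close> from the point; the exterior ball condition provides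
  these discs. The discs are not centred at the points, so superharmonicity of the kernel does not
  apply. Nevertheless only the interaction of pairs at distance below \<open>sqrt \<delta>\<close> can increase
  substantially, and for each of them by a bounded amount, whereas such a pair already contributes
  at least \<open>ln (1 / \<delta>) / 2\<close>. The energy \<open>F\<close> of the smeared configuration is thus at most
  \<open>(1 + \<kappa>) * Q + \<kappa> * C * n\<^sup>2\<close>, with \<open>\<kappa>\<close> arbitrarily small and \<open>\<delta>\<close> independent of \<open>n\<close>. There is no
  restriction to bounded configurations, because the potential grows faster than any multiple of the
  logarithm (\<open>potential_growth\<close>).

  Upper bound (\<open>hole_partition_function_upper\<close>): the average of the disc laws is a compactly
  supported probability measure outside \<open>U\<close>, so its energy is at least \<open>R\<close>. This bounds \<open>Q\<close> below by
  about \<open>\<beta> / 2 * R * n\<^sup>2\<close> for every configuration outside \<open>U\<close>, and integrating the weight gives the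
  claim.

  Lower bound (\<open>hole_partition_function_lower\<close>): for a measure with energy \<open>e\<close> close to \<open>R\<close>,
  independent points have mean energy about \<open>\<beta> / 2 * e * n\<^sup>2\<close>, so some configuration of distinct
  points outside \<open>U\<close> does not exceed it (\<open>exists_configuration\<close>). Jensen's inequality on the product
  of the discs around its points (\<open>hole_partition_function_ge\<close>) bounds \<open>Z\<^sub>U(n)\<close> below by
  \<open>(pi * \<delta>\<^sup>2) ^ n * exp (- F)\<close>, in which the first factor is negligible on the scale \<open>n\<^sup>2\<close>.
\<close>

section \<open>The logarithmic interaction of two discs\<close>

text \<open>
  The logarithmic kernel as a real function. Its value on the diagonal is \<open>0\<close>, since \<open>ln 0 = 0\<close>;
  the diagonal is a null set wherever the kernel is integrated.
\<close>

definition logk :: "complex \<Rightarrow> complex \<Rightarrow> real" where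
  "logk z w = - ln (cmod (z - w))"

text \<open>
  Density and law of the uniform distribution on the disc with centre \<open>\<eta>\<close> and radius \<open>\<delta>\<close>.
\<close>

definition disc_density :: "real \<Rightarrow> complex \<Rightarrow> complex \<Rightarrow> real" where
  "disc_density \<delta> \<eta> x = indicator (ball \<eta> \<delta>) x / (pi * \<delta>\<^sup>2)"

definition disc_law :: "real \<Rightarrow> complex \<Rightarrow> complex measure" where
  "disc_law \<delta> \<eta> = density lborel (\<lambda>x. ennreal (disc_density \<delta> \<eta> x))"

text \<open>
  The mutual logarithmic energy of the uniform distributions on two discs of the same radius.
\<close>

definition disc_interaction :: "real \<Rightarrow> complex \<Rightarrow> complex \<Rightarrow> real" where
  "disc_interaction \<delta> \<eta> \<xi> = (\<integral>(x, y). logk x y \<partial>(disc_law \<delta> \<eta> \<Otimes>\<^sub>M disc_law \<delta> \<xi>))"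

lemma logk_measurable [measurable]:
  "(\<lambda>p. logk (fst p) (snd p)) \<in> borel_measurable (borel \<Otimes>\<^sub>M borel)"
  unfolding logk_def by measurable

lemma logk_commute: "logk z w = logk w z"
  unfolding logk_def by (simp add: norm_minus_commute)

lemma disc_density_nonneg: "disc_density \<delta> \<eta> x \<ge> 0"
  unfolding disc_density_def by simp

lemma pred_ball [measurable]: "Measurable.pred borel (\<lambda>x::complex. x \<in> ball \<eta> \<delta>)"
  unfolding mem_ball by measurable

lemma disc_density_measurable [measurable]: "disc_density \<delta> \<eta> \<in> borel_measurable borel"
  unfolding disc_density_def by measurable

lemma sets_disc_law [simp, measurable_cong]: "sets (disc_law \<delta> \<eta>) = sets borel"
  unfolding disc_law_def by simp

lemma space_disc_law [simp]: "space (disc_law \<delta> \<eta>) = UNIV"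
  unfolding disc_law_def by simp

lemma emeasure_ball_complex: "r \<ge> 0 \<Longrightarrow> emeasure lborel (ball (c::complex) r) = ennreal (pi * r\<^sup>2)"
  by (simp add: emeasure_ball unit_ball_vol_2)

lemma emeasure_disc_law:
  assumes "\<delta> > 0" and [measurable]: "A \<in> sets borel"
  shows "emeasure (disc_law \<delta> \<eta>) A = ennreal (1 / (pi * \<delta>\<^sup>2)) * emeasure lborel (A \<inter> ball \<eta> \<delta>)"
proof -
  have "emeasure (disc_law \<delta> \<eta>) A = (\<integral>\<^sup>+x. ennreal (1 / (pi * \<delta>\<^sup>2)) * indicator (A \<inter> ball \<eta> \<delta>) x \<partial>lborel)"
    unfolding disc_law_def by (subst emeasure_density)
      (auto intro!: nn_integral_cong simp: disc_density_def indicator_def)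
  also have "\<dots> = ennreal (1 / (pi * \<delta>\<^sup>2)) * emeasure lborel (A \<inter> ball \<eta> \<delta>)"
    by (subst nn_integral_cmult_indicator) auto
  finally show ?thesis .
qed

lemma prob_space_disc_law:
  assumes "\<delta> > 0"
  shows "prob_space (disc_law \<delta> \<eta>)"
proof
  have "emeasure (disc_law \<delta> \<eta>) UNIV = ennreal (1 / (pi * \<delta>\<^sup>2)) * ennreal (pi * \<delta>\<^sup>2)"
    using assms by (subst emeasure_disc_law) (auto simp: emeasure_ball_complex)
  also have "\<dots> = 1"
    using assms by (subst ennreal_mult[symmetric]) auto
  finally show "emeasure (disc_law \<delta> \<eta>) (space (disc_law \<delta> \<eta>)) = 1" by simp
qed

lemma AE_disc_law:
  assumes "\<delta> > 0"
  shows "AE x in disc_law \<delta> \<eta>. x \<in> ball \<eta> \<delta>"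
  unfolding disc_law_def by (subst AE_density) (auto simp: disc_density_def indicator_def)

lemma AE_disc_law_pair:
  assumes "\<delta> > 0"
  shows "AE p in disc_law \<delta> \<eta> \<Otimes>\<^sub>M disc_law \<delta> \<xi>. fst p \<in> ball \<eta> \<delta> \<and> snd p \<in> ball \<xi> \<delta>"
proof -
  interpret A: prob_space "disc_law \<delta> \<eta>" by (rule prob_space_disc_law[OF assms])
  interpret B: prob_space "disc_law \<delta> \<xi>" by (rule prob_space_disc_law[OF assms])
  interpret AB: pair_prob_space "disc_law \<delta> \<eta>" "disc_law \<delta> \<xi>" ..
  show ?thesis
  proof (rule AB.AE_pair_measure)
    show "AE x in disc_law \<delta> \<eta>. AE y in disc_law \<delta> \<xi>. fst (x, y) \<in> ball \<eta> \<delta> \<and> snd (x, y) \<in> ball \<xi> \<delta>"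
      using AE_disc_law[OF assms, of \<eta>] AE_disc_law[OF assms, of \<xi>] by auto
  qed measurable
qed

text \<open>
  The logarithmic potential of a disc, relative to its radius, is at most \<open>2\<close> at every point: for
  \<open>x \<noteq> y\<close> the positive part of \<open>ln (\<delta> / cmod (x - y))\<close> is at most the number of \<open>k\<close> with
  \<open>cmod (x - y) < \<delta> * exp (- k)\<close>, and the disc law gives mass at most \<open>exp (- 2 * k)\<close> to the
  ball with centre \<open>y\<close> and radius \<open>\<delta> * exp (- k)\<close>.
\<close>

lemma nn_integral_disc_log_le:
  assumes "\<delta> > 0"
  shows "(\<integral>\<^sup>+x. ennreal (ln (\<delta> / cmod (x - y))) \<partial>disc_law \<delta> \<eta>) \<le> 2"
proof -
  have pointwise: "ennreal (ln (\<delta> / cmod (x - y))) \<le> (\<Sum>k. indicator (ball y (\<delta> * exp (- real k))) x)" for x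
  proof (cases "ln (\<delta> / cmod (x - y)) > 0")
    case True
    define u where "u = ln (\<delta> / cmod (x - y))"
    then have "u > 0" and "x \<noteq> y" using True by auto
    then have dist: "cmod (x - y) = \<delta> * exp (- u)"
      using assms by (simp add: u_def exp_minus)
    define N where "N = nat \<lceil>u\<rceil>"
    have "ennreal u \<le> ennreal (real N)"
      using \<open>u > 0\<close> by (auto intro!: ennreal_leI simp: N_def)
    also have "\<dots> = (\<Sum>k<N. 1)" by (simp add: ennreal_of_nat_eq_real_of_nat)
    also have "\<dots> \<le> (\<Sum>k<N. indicator (ball y (\<delta> * exp (- real k))) x)"
    proof (intro sum_mono)
      fix k assume "k \<in> {..<N}"
      then have "real k < u" unfolding N_def using \<open>u > 0\<close> by (simp, linarith)
      then have "x \<in> ball y (\<delta> * exp (- real k))"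
        using dist assms by (simp add: dist_norm norm_minus_commute)
      then show "(1::ennreal) \<le> indicator (ball y (\<delta> * exp (- real k))) x" by simp
    qed
    also have "\<dots> \<le> (\<Sum>k. indicator (ball y (\<delta> * exp (- real k))) x)"
      by (intro sum_le_suminf) auto
    finally show ?thesis unfolding u_def .
  qed (simp add: ennreal_neg)
  have "(\<integral>\<^sup>+x. ennreal (ln (\<delta> / cmod (x - y))) \<partial>disc_law \<delta> \<eta>)
      \<le> (\<integral>\<^sup>+x. (\<Sum>k. indicator (ball y (\<delta> * exp (- real k))) x) \<partial>disc_law \<delta> \<eta>)"
    by (intro nn_integral_mono pointwise)
  also have "\<dots> = (\<Sum>k. emeasure (disc_law \<delta> \<eta>) (ball y (\<delta> * exp (- real k))))"
    by (subst nn_integral_suminf) (auto intro!: borel_measurable_indicator)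
  also have "\<dots> \<le> (\<Sum>k. ennreal ((1/2) ^ k))"
  proof (intro suminf_le)
    fix k :: nat
    have "emeasure (disc_law \<delta> \<eta>) (ball y (\<delta> * exp (- real k)))
       \<le> ennreal (1 / (pi * \<delta>\<^sup>2)) * emeasure lborel (ball y (\<delta> * exp (- real k)))"
      using assms by (subst emeasure_disc_law) (auto intro!: mult_left_mono emeasure_mono)
    also have "\<dots> = ennreal (1 / (pi * \<delta>\<^sup>2) * (pi * (\<delta> * exp (- real k))\<^sup>2))"
      using assms by (subst emeasure_ball_complex) (auto simp: ennreal_mult[symmetric])
    also have "1 / (pi * \<delta>\<^sup>2) * (pi * (\<delta> * exp (- real k))\<^sup>2) = (exp (-2)) ^ k"
      using assms by (simp add: power_mult_distrib exp_of_nat_mult[symmetric] exp_double[symmetric])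
    also have "ennreal (exp (-2) ^ k) \<le> ennreal ((1/2) ^ k)"
    proof (intro ennreal_leI power_mono)
      have "2 \<le> exp (1::real)" using exp_ge_add_one_self[of 1] by simp
      also have "\<dots> \<le> exp 2" by simp
      finally show "exp (-2) \<le> (1/2::real)" by (simp add: exp_minus field_simps)
    qed auto
    finally show "emeasure (disc_law \<delta> \<eta>) (ball y (\<delta> * exp (- real k))) \<le> ennreal ((1/2) ^ k)" .
  qed auto
  also have "\<dots> = ennreal (\<Sum>k. (1/2) ^ k)"
    by (intro suminf_ennreal2) (auto simp: summable_geometric)
  also have "\<dots> = 2" by (simp add: suminf_geometric)
  finally show ?thesis .
qed

lemma logk_le:
  assumes "0 < \<delta>" "\<delta> < 1"
  shows "logk x y \<le> max 0 (ln (\<delta> / cmod (x - y))) + ln (1 / \<delta>)"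
  using assms by (cases "x = y") (auto simp: logk_def ln_div)

lemma
  assumes "0 < \<delta>" "\<delta> < 1"
  shows integrable_logk_disc: "integrable (disc_law \<delta> \<eta> \<Otimes>\<^sub>M disc_law \<delta> \<xi>) (\<lambda>p. logk (fst p) (snd p))"
    and disc_interaction_le: "disc_interaction \<delta> \<eta> \<xi> \<le> ln (1 / \<delta>) + 2"
proof -
  let ?A = "disc_law \<delta> \<eta>" and ?B = "disc_law \<delta> \<xi>"
  interpret A: prob_space ?A by (rule prob_space_disc_law[OF assms(1)])
  interpret B: prob_space ?B by (rule prob_space_disc_law[OF assms(1)])
  interpret AB: pair_prob_space ?A ?B ..
  define f where "f p = max 0 (ln (\<delta> / cmod (fst p - snd p)))" for p :: "complex \<times> complex"
  have [measurable]: "f \<in> borel_measurable (borel \<Otimes>\<^sub>M borel)" unfolding f_def by measurable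
  have nn: "(\<integral>\<^sup>+p. ennreal (f p) \<partial>(?A \<Otimes>\<^sub>M ?B)) \<le> 2"
  proof -
    have "(\<integral>\<^sup>+p. ennreal (f p) \<partial>(?A \<Otimes>\<^sub>M ?B)) = (\<integral>\<^sup>+y. \<integral>\<^sup>+x. ennreal (f (x, y)) \<partial>?A \<partial>?B)"
      by (subst AB.nn_integral_snd[symmetric]) auto
    also have "\<dots> \<le> (\<integral>\<^sup>+y. 2 \<partial>?B)"
    proof (intro nn_integral_mono)
      fix y
      have "(\<integral>\<^sup>+x. ennreal (f (x, y)) \<partial>?A) = (\<integral>\<^sup>+x. ennreal (ln (\<delta> / cmod (x - y))) \<partial>?A)"
        by (intro nn_integral_cong) (simp add: f_def max_def ennreal_neg)
      also have "\<dots> \<le> 2" by (rule nn_integral_disc_log_le[OF assms(1)])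
      finally show "(\<integral>\<^sup>+x. ennreal (f (x, y)) \<partial>?A) \<le> 2" .
    qed
    also have "\<dots> = 2" using B.emeasure_space_1 by simp
    finally show ?thesis .
  qed
  have f_int: "integrable (?A \<Otimes>\<^sub>M ?B) f"
    using nn by (intro integrableI_nonneg) (auto simp: f_def order_le_less_trans)
  have f_le: "integral\<^sup>L (?A \<Otimes>\<^sub>M ?B) f \<le> 2"
    using nn f_int by (subst (asm) nn_integral_eq_integral) (auto simp: f_def ennreal_le_iff2[of _ 2, simplified])
  have ae: "AE p in ?A \<Otimes>\<^sub>M ?B. fst p \<in> ball \<eta> \<delta> \<and> snd p \<in> ball \<xi> \<delta>"
    by (rule AE_disc_law_pair[OF assms(1)])
  define D where "D = cmod (\<eta> - \<xi>) + 2 * \<delta>"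
  have "D > 0" using assms by (simp add: D_def add_nonneg_pos)
  \<comment> \<open>The discs have bounded diameter, so the kernel is bounded below on their product.\<close>
  have lower: "- \<bar>ln D\<bar> \<le> logk x y" if "x \<in> ball \<eta> \<delta>" "y \<in> ball \<xi> \<delta>" for x y
  proof (cases "x = y")
    case False
    have "dist x y \<le> dist \<eta> x + dist \<eta> \<xi> + dist \<xi> y"
      by (smt (verit) dist_commute dist_triangle)
    then have "cmod (x - y) \<le> D" using that by (simp add: D_def dist_norm)
    then have "ln (cmod (x - y)) \<le> ln D" using False by (subst ln_le_cancel_iff) (auto simp: \<open>D > 0\<close>)
    then show ?thesis unfolding logk_def by linarith
  qed (simp add: logk_def)
  show int: "integrable (?A \<Otimes>\<^sub>M ?B) (\<lambda>p. logk (fst p) (snd p))"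
  proof (rule Bochner_Integration.integrable_bound[where f = "\<lambda>p. f p + (ln (1 / \<delta>) + \<bar>ln D\<bar>)"])
    show "integrable (?A \<Otimes>\<^sub>M ?B) (\<lambda>p. f p + (ln (1 / \<delta>) + \<bar>ln D\<bar>))"
      using f_int by auto
    have bound: "norm (logk x y) \<le> norm (f (x, y) + (ln (1 / \<delta>) + \<bar>ln D\<bar>))"
      if "x \<in> ball \<eta> \<delta>" "y \<in> ball \<xi> \<delta>" for x y
    proof -
      have "ln (1 / \<delta>) \<ge> 0" "f (x, y) \<ge> 0" using assms by (auto simp: f_def)
      then show ?thesis
        using lower[OF that] logk_le[OF assms, of x y] unfolding f_def fst_conv snd_conv real_norm_def
        by linarith
    qed
    show "AE p in ?A \<Otimes>\<^sub>M ?B. norm (logk (fst p) (snd p)) \<le> norm (f p + (ln (1 / \<delta>) + \<bar>ln D\<bar>))"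
      using ae
    proof eventually_elim
      case (elim p)
      then show ?case using bound[of "fst p" "snd p"] by simp
    qed
  qed measurable
  have "disc_interaction \<delta> \<eta> \<xi> \<le> (\<integral>p. f p + ln (1 / \<delta>) \<partial>(?A \<Otimes>\<^sub>M ?B))"
    unfolding disc_interaction_def case_prod_beta
  proof (rule integral_mono[OF int])
    show "integrable (?A \<Otimes>\<^sub>M ?B) (\<lambda>p. f p + ln (1 / \<delta>))" using f_int by auto
    show "logk (fst p) (snd p) \<le> f p + ln (1 / \<delta>)" for p
      using logk_le[OF assms, of "fst p" "snd p"] unfolding f_def .
  qed
  also have "\<dots> \<le> 2 + ln (1 / \<delta>)"
    using f_int f_le AB.prob_space by simp
  finally show "disc_interaction \<delta> \<eta> \<xi> \<le> ln (1 / \<delta>) + 2" by simp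
qed

lemma disc_interaction_le_const:
  assumes "0 < \<delta>" "\<delta> < 1" and far: "\<And>x y. x \<in> ball \<eta> \<delta> \<Longrightarrow> y \<in> ball \<xi> \<delta> \<Longrightarrow> logk x y \<le> c"
  shows "disc_interaction \<delta> \<eta> \<xi> \<le> c"
proof -
  let ?A = "disc_law \<delta> \<eta>" and ?B = "disc_law \<delta> \<xi>"
  interpret A: prob_space ?A by (rule prob_space_disc_law[OF assms(1)])
  interpret B: prob_space ?B by (rule prob_space_disc_law[OF assms(1)])
  interpret AB: pair_prob_space ?A ?B ..
  have ae: "AE p in ?A \<Otimes>\<^sub>M ?B. fst p \<in> ball \<eta> \<delta> \<and> snd p \<in> ball \<xi> \<delta>"
    by (rule AE_disc_law_pair[OF assms(1)])
  show ?thesis unfolding disc_interaction_def case_prod_beta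
  proof (rule AB.integral_le_const)
    show "integrable (?A \<Otimes>\<^sub>M ?B) (\<lambda>p. logk (fst p) (snd p))"
      by (rule integrable_logk_disc[OF assms(1,2)])
    show "AE p in ?A \<Otimes>\<^sub>M ?B. logk (fst p) (snd p) \<le> c"
      using ae by eventually_elim (auto intro: far)
  qed
qed

section \<open>Growth of the potential\<close>

text \<open>
  Monotonicity and the moment conditions alone make the potential grow faster than any multiple of
  the logarithm: the moment integral over \<open>{r..2 * r}\<close> is at least
  \<open>r ^ (2 * m + 2) * exp (- g (2 * r))\<close>.
\<close>

lemma potential_growth:
  assumes "admissible_potential g"
  shows "\<exists>C. \<forall>r\<ge>0. real m * ln (1 + r) \<le> g r + C"
proof -
  have nonneg: "\<And>r. r \<ge> 0 \<Longrightarrow> g r \<ge> 0" and mono: "mono_on {0..} g"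
    and int: "set_integrable lborel {0..} (\<lambda>r. r ^ (2 * m + 1) * exp (- g r))"
    using assms unfolding admissible_potential_def by auto
  define I where "I = (LINT r:{0..}|lborel. r ^ (2 * m + 1) * exp (- g r))"
  have moment: "r ^ (2 * m + 2) * exp (- g (2 * r)) \<le> I" if "r \<ge> 0" for r
  proof -
    have "r ^ (2 * m + 2) * exp (- g (2 * r)) = (LINT s:{r..2*r}|lborel. r ^ (2 * m + 1) * exp (- g (2 * r)))"
      using that by (subst set_integral_const) (auto simp: algebra_simps)
    also have "\<dots> \<le> I"
      unfolding I_def set_lebesgue_integral_def
    proof (rule integral_mono)
      show "integrable lborel (\<lambda>s. indicator {r..2*r} s *\<^sub>R (r ^ (2 * m + 1) * exp (- g (2 * r))))"
        using that by (intro integrable_scaleR_left integrable_real_indicator) auto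
      show "integrable lborel (\<lambda>s. indicator {0..} s *\<^sub>R (s ^ (2 * m + 1) * exp (- g s)))"
        using int unfolding set_integrable_def .
      fix s
      show "indicator {r..2*r} s *\<^sub>R (r ^ (2 * m + 1) * exp (- g (2 * r)))
          \<le> indicator {0..} s *\<^sub>R (s ^ (2 * m + 1) * exp (- g s))"
      proof (cases "s \<in> {r..2*r}")
        case True
        then have "g s \<le> g (2 * r)" using mono that by (auto simp: mono_on_def)
        then show ?thesis using True that by (auto intro!: mult_mono power_mono)
      qed (auto simp: indicator_def)
    qed
    finally show ?thesis .
  qed
  have "I > 0" using moment[of 1] by (rule_tac less_le_trans) auto
  define C where "C = real m * ln 2 + \<bar>ln I\<bar> + (2 * m + 2) * ln 4"
  have "real m * ln (1 + r) \<le> g r + C" if r: "r \<ge> 0" for r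
  proof (cases "r \<le> 1")
    case True
    have "real m * ln (1 + r) \<le> real m * ln 2"
      using True r by (intro mult_left_mono) auto
    then show ?thesis using nonneg[OF r] unfolding C_def by (simp add: add_increasing2 add_increasing)
  next
    case False
    have "((1 + r) / 4) ^ (2 * m + 2) * exp (- g r) \<le> (r / 2) ^ (2 * m + 2) * exp (- g r)"
      using False by (intro mult_right_mono power_mono) auto
    also have "\<dots> \<le> I" using moment[of "r / 2"] r by simp
    finally have "ln (((1 + r) / 4) ^ (2 * m + 2) * exp (- g r)) \<le> ln I"
      using r \<open>I > 0\<close> by (subst ln_le_cancel_iff) (auto intro!: mult_pos_pos zero_less_power)
    also have "ln (((1 + r) / 4) ^ (2 * m + 2) * exp (- g r)) = ln (((1 + r) / 4) ^ (2 * m + 2)) + ln (exp (- g r))"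
      using r by (intro ln_mult_pos) auto
    also have "\<dots> = real (2 * m + 2) * (ln (1 + r) - ln 4) - g r"
      using r by (simp add: ln_realpow ln_div del: power_Suc)
    finally have "(2 * m + 2) * ln (1 + r) \<le> g r + ln I + (2 * m + 2) * ln 4"
      by (simp add: algebra_simps)
    moreover have "real m * ln (1 + r) \<le> (2 * m + 2) * ln (1 + r)"
      using r by (intro mult_right_mono) auto
    moreover have "real m * ln 2 \<ge> 0" by simp
    ultimately show ?thesis unfolding C_def using abs_ge_self[of "ln I"] by linarith
  qed
  then show ?thesis by blast
qed

section \<open>Moving points into discs outside the hole\<close>

text \<open>
  The exterior ball at a nearby boundary point contains a ball of any smaller radius \<open>\<delta>\<close> that
  touches the same boundary point.
\<close>

lemma exterior_ball_shift:
  assumes "open U" and \<epsilon>: "\<epsilon> > 0" "\<forall>z\<in>frontier U. \<exists>\<eta>\<in>- U. ball \<eta> \<epsilon> \<subseteq> - U \<and> cmod (z - \<eta>) = \<epsilon>"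
    and \<delta>: "0 < \<delta>" "\<delta> \<le> \<epsilon>" and z: "z \<notin> U"
  shows "\<exists>\<eta>. cmod (\<eta> - z) \<le> 2 * \<delta> \<and> ball \<eta> \<delta> \<subseteq> - U"
proof (cases "ball z \<delta> \<subseteq> - U")
  case True
  then show ?thesis using \<delta> by (intro exI[of _ z]) auto
next
  case False
  then have "ball z \<delta> \<inter> U \<noteq> {}" "ball z \<delta> - U \<noteq> {}"
    using z \<delta> centre_in_ball[of z \<delta>] by blast+
  then obtain p where p: "p \<in> ball z \<delta>" "p \<in> frontier U"
    using connected_Int_frontier[of "ball z \<delta>" U] by auto
  then obtain c where c: "ball c \<epsilon> \<subseteq> - U" "cmod (p - c) = \<epsilon>" using \<epsilon> by auto
  \<comment> \<open>The ball of radius \<open>\<delta>\<close> that touches the exterior ball from inside at \<open>p\<close>.\<close>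
  define \<eta> where "\<eta> = p + (\<delta> / \<epsilon>) *\<^sub>R (c - p)"
  have "cmod (\<eta> - p) = \<delta>"
    using c \<epsilon> \<delta> by (simp add: \<eta>_def norm_minus_commute)
  have "c - \<eta> = (1 - \<delta> / \<epsilon>) *\<^sub>R (c - p)" by (simp add: \<eta>_def algebra_simps)
  then have "cmod (c - \<eta>) = \<bar>1 - \<delta> / \<epsilon>\<bar> * \<epsilon>" using c by (simp add: norm_minus_commute)
  moreover have "\<bar>1 - \<delta> / \<epsilon>\<bar> = 1 - \<delta> / \<epsilon>" using \<epsilon> \<delta> by simp
  ultimately have d: "cmod (c - \<eta>) = \<epsilon> - \<delta>" using \<epsilon> by (simp add: left_diff_distrib)
  have "ball \<eta> \<delta> \<subseteq> ball c \<epsilon>"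
  proof
    fix x assume "x \<in> ball \<eta> \<delta>"
    then show "x \<in> ball c \<epsilon>"
      using d dist_triangle[of c x \<eta>] by (simp add: dist_norm)
  qed
  moreover have "cmod (\<eta> - z) \<le> 2 * \<delta>"
    using p(1) norm_triangle_ineq[of "\<eta> - p" "p - z"] \<open>cmod (\<eta> - p) = \<delta>\<close>
    by (simp add: dist_norm norm_minus_commute)
  ultimately show ?thesis using c by blast
qed

lemma neg_logk_le: "- logk z w \<le> ln (1 + cmod z) + ln (1 + cmod w)"
proof (cases "z = w")
  case False
  have "cmod (z - w) \<le> cmod z + cmod w" by (rule norm_triangle_ineq4)
  also have "\<dots> \<le> (1 + cmod z) * (1 + cmod w)" by (simp add: algebra_simps)
  finally have "ln (cmod (z - w)) \<le> ln ((1 + cmod z) * (1 + cmod w))"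
    using False by (intro ln_mono) auto
  also have "\<dots> = ln (1 + cmod z) + ln (1 + cmod w)"
    by (intro ln_mult_pos) (auto intro!: add_pos_nonneg)
  finally show ?thesis by (simp add: logk_def)
qed (simp add: logk_def)

text \<open>
  Replacing two distinct points by discs of small radius \<open>\<delta>\<close>, with centres displaced by at most
  \<open>2 * \<delta>\<close>, increases their logarithmic interaction by at most a small multiple of the
  nonnegative quantity \<open>logk z w + ln (1 + cmod z) + ln (1 + cmod w)\<close> and a small constant. If
  the points are at distance at least \<open>sqrt \<delta>\<close>, the kernel changes little on the discs. If they are
  closer, the increase is at most an absolute constant, and the bracket is at least
  \<open>ln (1 / \<delta>) / 2\<close>, so a small multiple of it absorbs this constant.
\<close>

lemma disc_interaction_comparison:
  assumes "\<kappa> > 0"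
  shows "\<exists>\<delta>0>0. \<forall>\<delta>. 0 < \<delta> \<longrightarrow> \<delta> \<le> \<delta>0 \<longrightarrow> (\<forall>z w \<eta> \<xi>. z \<noteq> w \<longrightarrow> cmod (\<eta> - z) \<le> 2 * \<delta> \<longrightarrow> cmod (\<xi> - w) \<le> 2 * \<delta> \<longrightarrow>
    disc_interaction \<delta> \<eta> \<xi> \<le> (1 + \<kappa>) * logk z w + \<kappa> * (ln (1 + cmod z) + ln (1 + cmod w)) + \<kappa>)"
proof -
  \<comment> \<open>The second bound makes \<open>12 * sqrt \<delta> \<le> 1 - exp (- \<kappa>)\<close> (distant points), the third makes \<open>\<kappa> * ln (1 / \<delta>) / 2 \<ge> 6\<close> (close points).\<close>
  define \<delta>0 where "\<delta>0 = min (1/4) (min (((1 - exp (- \<kappa>)) / 12)\<^sup>2) (exp (- 12 / \<kappa>)))"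
  have "\<delta>0 > 0" using assms by (simp add: \<delta>0_def)
  moreover have "disc_interaction \<delta> \<eta> \<xi> \<le> (1 + \<kappa>) * logk z w + \<kappa> * (ln (1 + cmod z) + ln (1 + cmod w)) + \<kappa>"
    if \<delta>: "0 < \<delta>" "\<delta> \<le> \<delta>0" and "z \<noteq> w" and \<eta>: "cmod (\<eta> - z) \<le> 2 * \<delta>" "cmod (\<xi> - w) \<le> 2 * \<delta>" for \<delta> z w \<eta> \<xi>
  proof -
    define d where "d = cmod (z - w)"
    have "d > 0" using \<open>z \<noteq> w\<close> by (simp add: d_def)
    have \<delta>1: "\<delta> < 1" using \<delta> by (simp add: \<delta>0_def)
    define s where "s = sqrt \<delta>"
    have s: "s > 0" "s\<^sup>2 = \<delta>" using \<delta> by (auto simp: s_def)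
    have "\<delta> \<le> ((1 - exp (- \<kappa>)) / 12)\<^sup>2" using \<delta> by (simp add: \<delta>0_def)
    then have s_le: "s \<le> (1 - exp (- \<kappa>)) / 12"
      unfolding s_def using assms by (intro real_le_lsqrt) auto
    have bracket: "0 \<le> logk z w + ln (1 + cmod z) + ln (1 + cmod w)"
      using neg_logk_le[of z w] by linarith
    have dist_lower: "cmod (x - y) \<ge> d - 6 * \<delta>" if "x \<in> ball \<eta> \<delta>" "y \<in> ball \<xi> \<delta>" for x y
    proof -
      have "d \<le> cmod (z - \<eta>) + cmod (\<eta> - x) + cmod (x - y) + cmod (y - \<xi>) + cmod (\<xi> - w)"
      proof -
        have "d = cmod ((z - \<eta>) + (\<eta> - x) + (x - y) + (y - \<xi>) + (\<xi> - w))" by (simp add: d_def)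
        also have "\<dots> \<le> cmod (z - \<eta>) + cmod (\<eta> - x) + cmod (x - y) + cmod (y - \<xi>) + cmod (\<xi> - w)"
          by (intro norm_triangle_mono order_refl)
        finally show ?thesis .
      qed
      then show ?thesis using that \<eta> by (simp add: dist_norm norm_minus_commute)
    qed
    show ?thesis
    proof (cases "d \<ge> s")
      case True
      have "disc_interaction \<delta> \<eta> \<xi> \<le> logk z w + \<kappa>"
      proof (rule disc_interaction_le_const[OF \<delta>(1) \<delta>1])
        fix x y assume xy: "x \<in> ball \<eta> \<delta>" "y \<in> ball \<xi> \<delta>"
        have "6 * \<delta> \<le> 12 * s * d" using True s by (auto simp: power2_eq_square s(2)[symmetric] intro: mult_mono)
        also have "\<dots> \<le> (1 - exp (- \<kappa>)) * d" using s_le \<open>d > 0\<close> by (intro mult_right_mono) auto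
        finally have "exp (- \<kappa>) * d \<le> cmod (x - y)"
          using dist_lower[OF xy] by (simp add: algebra_simps)
        then have "ln (exp (- \<kappa>) * d) \<le> ln (cmod (x - y))"
          using \<open>d > 0\<close> by (intro ln_mono mult_pos_pos) auto
        then show "logk x y \<le> logk z w + \<kappa>"
          using \<open>d > 0\<close> by (simp add: logk_def ln_mult_pos d_def)
      qed
      also have "\<dots> \<le> logk z w + \<kappa> + \<kappa> * (logk z w + ln (1 + cmod z) + ln (1 + cmod w))"
        using bracket assms by simp
      finally show ?thesis by (simp add: algebra_simps)
    next
      case False
      have "disc_interaction \<delta> \<eta> \<xi> \<le> logk z w + 6"
      proof (cases "d \<ge> 12 * \<delta>")
        case True
        have "disc_interaction \<delta> \<eta> \<xi> \<le> logk z w + 1"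
        proof (rule disc_interaction_le_const[OF \<delta>(1) \<delta>1])
          fix x y assume xy: "x \<in> ball \<eta> \<delta>" "y \<in> ball \<xi> \<delta>"
          have "exp 1 \<ge> (2::real)" using exp_ge_add_one_self[of 1] by simp
          then have "exp (- 1) \<le> (1/2::real)" by (simp add: exp_minus field_simps)
          then have "exp (- 1) * d \<le> 1/2 * d" using \<open>d > 0\<close> by (intro mult_right_mono) auto
          also have "1/2 * d \<le> cmod (x - y)"
            using dist_lower[OF xy] True by (simp add: algebra_simps)
          finally have "ln (exp (- 1) * d) \<le> ln (cmod (x - y))"
            using \<open>d > 0\<close> by (intro ln_mono mult_pos_pos) auto
          then show "logk x y \<le> logk z w + 1"
            using \<open>d > 0\<close> by (simp add: logk_def ln_mult_pos d_def)
        qed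
        then show ?thesis by simp
      next
        case far: False
        have "2 \<le> exp (1::real)" using exp_ge_add_one_self[of 1] by simp
        then have "(2::real) ^ 4 \<le> exp 1 ^ 4" by (intro power_mono) auto
        then have "12 \<le> exp (4::real)" by (simp add: exp_of_nat_mult[symmetric])
        then have "12 * \<delta> \<le> exp 4 * \<delta>" using \<delta> by (intro mult_right_mono) auto
        then have "d \<le> exp 4 * \<delta>" using far by linarith
        then have "ln d \<le> ln (exp 4 * \<delta>)" using \<open>d > 0\<close> \<delta> by (subst ln_le_cancel_iff) auto
        then have "ln (1 / \<delta>) \<le> logk z w + 4"
          using \<delta> by (simp add: ln_mult_pos ln_div logk_def d_def)
        then show ?thesis using disc_interaction_le[OF \<delta>(1) \<delta>1, of \<eta> \<xi>] by simp
      qed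
      moreover have "6 \<le> \<kappa> * (logk z w + ln (1 + cmod z) + ln (1 + cmod w))"
      proof -
        have "\<delta> \<le> exp (- 12 / \<kappa>)" using \<delta> by (simp add: \<delta>0_def)
        then have "ln \<delta> \<le> - 12 / \<kappa>" using \<delta> by (metis ln_exp ln_mono exp_gt_zero)
        moreover have "ln d \<le> ln \<delta> / 2"
        proof -
          have "ln d \<le> ln s" using False \<open>d > 0\<close> by (subst ln_le_cancel_iff) auto
          also have "ln s = ln \<delta> / 2" unfolding s_def using \<delta> by (simp add: ln_sqrt)
          finally show ?thesis .
        qed
        ultimately have "6 / \<kappa> \<le> logk z w" by (simp add: logk_def d_def)
        then have "6 / \<kappa> \<le> logk z w + ln (1 + cmod z) + ln (1 + cmod w)"
          by (simp add: add_increasing2)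
        then have "\<kappa> * (6 / \<kappa>) \<le> \<kappa> * (logk z w + ln (1 + cmod z) + ln (1 + cmod w))"
          using assms by (intro mult_left_mono) auto
        then show ?thesis using assms by simp
      qed
      ultimately show ?thesis using assms by (simp add: algebra_simps)
    qed
  qed
  ultimately show ?thesis by blast
qed

section \<open>The energy of a configuration\<close>

text \<open>
  Minus the logarithm of the weight of a configuration of distinct points.
\<close>

definition gas_energy :: "(real \<Rightarrow> real) \<Rightarrow> real \<Rightarrow> nat \<Rightarrow> (nat \<Rightarrow> complex) \<Rightarrow> real" where
  "gas_energy g \<beta> n z = \<beta> * (\<Sum>j<n. \<Sum>i<j. logk (z i) (z j)) + real n * (\<Sum>k<n. g (cmod (z k)))"

lemma gas_weight_eq_exp:
  assumes "inj_on z {..<n}"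
  shows "gas_weight g \<beta> n z = exp (- gas_energy g \<beta> n z)"
proof -
  have "(\<Prod>j<n. \<Prod>i<j. cmod (z i - z j) powr \<beta>) = (\<Prod>j<n. \<Prod>i<j. exp (- \<beta> * logk (z i) (z j)))"
  proof (intro prod.cong refl)
    fix i j assume "j \<in> {..<n}" "i \<in> {..<j}"
    then have "z i \<noteq> z j" using assms by (auto dest: inj_onD)
    then show "cmod (z i - z j) powr \<beta> = exp (- \<beta> * logk (z i) (z j))"
      by (simp add: powr_def logk_def)
  qed
  also have "\<dots> = exp (- \<beta> * (\<Sum>j<n. \<Sum>i<j. logk (z i) (z j)))"
    by (simp add: exp_sum[symmetric] sum_distrib_left)
  finally show ?thesis
    unfolding gas_weight_def gas_energy_def by (simp add: exp_add[symmetric])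
qed

lemma pair_sum_le:
  fixes l :: "nat \<Rightarrow> real"
  assumes "\<And>i. l i \<ge> 0"
  shows "(\<Sum>j<n. \<Sum>i<j. l i + l j) \<le> real n * (\<Sum>i<n. l i)"
proof (induction n)
  case (Suc n)
  have "(\<Sum>j<Suc n. \<Sum>i<j. l i + l j) = (\<Sum>j<n. \<Sum>i<j. l i + l j) + (\<Sum>i<n. l i) + real n * l n"
    by (simp add: sum.distrib)
  also have "\<dots> \<le> real n * (\<Sum>i<n. l i) + (\<Sum>i<n. l i) + real n * l n + l n"
    using Suc assms by (simp add: add_increasing2)
  also have "\<dots> = real (Suc n) * (\<Sum>i<Suc n. l i)" by (simp add: algebra_simps)
  finally show ?case .
qed simp

text \<open>
  The properties of the potential and of the hole on which the argument rests. The empty set is an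
  admissible hole, so that the partition function of the whole plane is covered as well.
\<close>

locale gas_with_hole =
  fixes g :: "real \<Rightarrow> real" and \<beta> T :: real and U :: "complex set"
  assumes g_nonneg: "\<And>r. r \<ge> 0 \<Longrightarrow> g r \<ge> 0"
    and g_mono: "mono_on {0..} g"
    and g_cont: "continuous_on {0..} g"
    and g_growth: "\<And>m::nat. \<exists>C. \<forall>r\<ge>0. real m * ln (1 + r) \<le> g r + C"
    and \<beta>_pos: "\<beta> > 0"
    and T_pos: "T > 0"
    and open_U: "open U"
    and U_subset: "U \<subseteq> ball 0 T"
    and exterior_U: "exterior_ball_condition U"
begin

abbreviation "Q \<equiv> gas_energy g \<beta>"

lemma continuous_g_cmod: "continuous_on UNIV (\<lambda>z::complex. g (cmod z))"
  by (rule continuous_on_compose2[OF g_cont]) (auto intro!: continuous_intros)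

lemma g_cmod_measurable [measurable]: "(\<lambda>z::complex. g (cmod z)) \<in> borel_measurable borel"
  by (rule borel_measurable_continuous_onI[OF continuous_g_cmod])

text \<open>
  As the potential outgrows the logarithm, the energy of a configuration controls its total
  potential and the logarithmic size of its points, up to an error of order \<open>n\<^sup>2\<close>.
\<close>

lemma gas_energy_lower_bounds:
  "\<exists>C\<ge>0. \<forall>n z. real n * (\<Sum>k<n. g (cmod (z k))) / 2 - C * (real n)\<^sup>2 \<le> Q n z \<and>
    real n * \<beta> * (\<Sum>k<n. ln (1 + cmod (z k))) \<le> Q n z + C * (real n)\<^sup>2"
proof -
  obtain m where m: "2 * \<beta> \<le> real m" using real_arch_simple by blast
  obtain C where C: "\<And>r. r \<ge> 0 \<Longrightarrow> real m * ln (1 + r) \<le> g r + C" using g_growth by blast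
  define l where "l z k = ln (1 + cmod (z k))" for z :: "nat \<Rightarrow> complex" and k
  have l0: "l z k \<ge> 0" for z k by (simp add: l_def)
  have lg: "2 * \<beta> * l z k \<le> g (cmod (z k)) + \<bar>C\<bar>" for z k
  proof -
    have "2 * \<beta> * l z k \<le> real m * l z k" using m l0 by (intro mult_right_mono) auto
    also have "\<dots> \<le> g (cmod (z k)) + C" unfolding l_def by (rule C) simp
    finally show ?thesis by simp
  qed
  have L: "2 * \<beta> * (\<Sum>k<n. l z k) \<le> (\<Sum>k<n. g (cmod (z k))) + real n * \<bar>C\<bar>" for n z
  proof -
    have "(\<Sum>k<n. 2 * \<beta> * l z k) \<le> (\<Sum>k<n. g (cmod (z k)) + \<bar>C\<bar>)" by (intro sum_mono lg)
    then show ?thesis by (simp add: sum_distrib_left sum.distrib)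
  qed
  have nL: "real n * \<beta> * (\<Sum>k<n. l z k) \<le> real n * (\<Sum>k<n. g (cmod (z k))) / 2 + \<bar>C\<bar> / 2 * (real n)\<^sup>2" for n z
  proof -
    have "real n * (2 * \<beta> * (\<Sum>k<n. l z k)) \<le> real n * ((\<Sum>k<n. g (cmod (z k))) + real n * \<bar>C\<bar>)"
      by (intro mult_left_mono L) simp
    then show ?thesis by (simp add: algebra_simps power2_eq_square)
  qed
  have QL: "- (real n * \<beta> * (\<Sum>k<n. l z k)) + real n * (\<Sum>k<n. g (cmod (z k))) \<le> Q n z" for n z
  proof -
    have "(\<Sum>j<n. \<Sum>i<j. - logk (z i) (z j)) \<le> (\<Sum>j<n. \<Sum>i<j. l z i + l z j)"
      unfolding l_def by (intro sum_mono neg_logk_le)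
    also have "\<dots> \<le> real n * (\<Sum>k<n. l z k)" by (rule pair_sum_le) (rule l0)
    finally have "\<beta> * - (\<Sum>j<n. \<Sum>i<j. logk (z i) (z j)) \<le> \<beta> * (real n * (\<Sum>k<n. l z k))"
      using \<beta>_pos by (intro mult_left_mono) (auto simp: sum_negf)
    then show ?thesis unfolding gas_energy_def by (simp add: algebra_simps)
  qed
  have C2: "\<bar>C\<bar> / 2 * (real n)\<^sup>2 \<le> \<bar>C\<bar> * (real n)\<^sup>2" for n by (intro mult_right_mono) auto
  have "real n * (\<Sum>k<n. g (cmod (z k))) / 2 - \<bar>C\<bar> * (real n)\<^sup>2 \<le> Q n z \<and>
    real n * \<beta> * (\<Sum>k<n. ln (1 + cmod (z k))) \<le> Q n z + \<bar>C\<bar> * (real n)\<^sup>2" for n z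
    using QL[of n z] nL[of n z] C2[of n] unfolding l_def by linarith
  then show ?thesis by (intro exI[of _ "\<bar>C\<bar>"]) simp
qed

text \<open>
  Points close to the hole are moved by the exterior ball condition, and the potential is uniformly
  continuous there. Points farther out are moved towards the origin by exactly \<open>\<delta>\<close>, so that no
  point of the disc is farther from the origin than the original point and monotonicity of the
  potential applies.
\<close>

lemma exists_disc_outside_hole:
  assumes "\<omega> > 0"
  shows "\<exists>\<delta>0>0. \<forall>\<delta>. 0 < \<delta> \<longrightarrow> \<delta> \<le> \<delta>0 \<longrightarrow> (\<forall>z. z \<notin> U \<longrightarrow>
    (\<exists>\<eta>. cmod (\<eta> - z) \<le> 2 * \<delta> \<and> ball \<eta> \<delta> \<subseteq> - U \<and> (\<forall>x\<in>ball \<eta> \<delta>. g (cmod x) \<le> g (cmod z) + \<omega>)))"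
proof -
  obtain \<epsilon> where \<epsilon>: "\<epsilon> > 0" "\<forall>z\<in>frontier U. \<exists>\<eta>\<in>- U. ball \<eta> \<epsilon> \<subseteq> - U \<and> cmod (z - \<eta>) = \<epsilon>"
    using exterior_U unfolding exterior_ball_condition_def by blast
  have "uniformly_continuous_on {0..T + 1} g"
    by (intro compact_uniformly_continuous continuous_on_subset[OF g_cont]) auto
  then obtain d where d: "d > 0" "\<And>r s. r \<in> {0..T+1} \<Longrightarrow> s \<in> {0..T+1} \<Longrightarrow> dist s r < d \<Longrightarrow> dist (g s) (g r) < \<omega>"
    using assms unfolding uniformly_continuous_on_def by blast
  define \<delta>0 where "\<delta>0 = min \<epsilon> (min (1/8) (d/4))"
  have "\<delta>0 > 0" using \<epsilon> d by (simp add: \<delta>0_def)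
  moreover have "\<exists>\<eta>. cmod (\<eta> - z) \<le> 2 * \<delta> \<and> ball \<eta> \<delta> \<subseteq> - U \<and> (\<forall>x\<in>ball \<eta> \<delta>. g (cmod x) \<le> g (cmod z) + \<omega>)"
    if \<delta>: "0 < \<delta>" "\<delta> \<le> \<delta>0" and z: "z \<notin> U" for \<delta> z
  proof (cases "cmod z \<ge> T + 1 / 2")
    case True
    have \<delta>18: "\<delta> \<le> 1/8" using \<delta> by (simp add: \<delta>0_def)
    have "cmod z > 0" using True T_pos by linarith
    define \<eta> where "\<eta> = (1 - \<delta> / cmod z) *\<^sub>R z"
    have "\<eta> - z = - ((\<delta> / cmod z) *\<^sub>R z)" by (simp add: \<eta>_def algebra_simps)
    then have \<eta>z: "cmod (\<eta> - z) = \<delta>" using \<open>cmod z > 0\<close> \<delta> by simp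
    have "\<delta> / cmod z \<le> 1" using \<delta>18 True T_pos \<open>cmod z > 0\<close> by (simp add: divide_le_eq)
    then have "cmod \<eta> = (1 - \<delta> / cmod z) * cmod z" by (simp add: \<eta>_def)
    then have \<eta>n: "cmod \<eta> = cmod z - \<delta>" using \<open>cmod z > 0\<close> by (simp add: left_diff_distrib)
    have "x \<notin> U \<and> g (cmod x) \<le> g (cmod z) + \<omega>" if "x \<in> ball \<eta> \<delta>" for x
    proof
      have x: "cmod (x - \<eta>) < \<delta>" using that by (simp add: dist_norm norm_minus_commute)
      have "cmod x \<ge> cmod \<eta> - cmod (x - \<eta>)" using norm_triangle_ineq2[of \<eta> "\<eta> - x"]
        by (simp add: norm_minus_commute)
      then have "cmod x > T" using \<eta>n x True \<delta>18 by linarith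
      then show "x \<notin> U" using U_subset by auto
      have "cmod x \<le> cmod z" using norm_triangle_ineq[of \<eta> "x - \<eta>"] x \<eta>n by simp
      then have "g (cmod x) \<le> g (cmod z)" using g_mono by (auto simp: mono_on_def)
      then show "g (cmod x) \<le> g (cmod z) + \<omega>" using assms by simp
    qed
    then show ?thesis using \<eta>z \<delta> by (intro exI[of _ \<eta>]) auto
  next
    case False
    have \<delta>': "\<delta> \<le> 1/8" "\<delta> \<le> \<epsilon>" "\<delta> \<le> d / 4" using \<delta> by (auto simp: \<delta>0_def)
    obtain \<eta> where \<eta>: "cmod (\<eta> - z) \<le> 2 * \<delta>" "ball \<eta> \<delta> \<subseteq> - U"
      using exterior_ball_shift[OF open_U \<epsilon> \<delta>(1) \<delta>'(2) z] by blast
    have "g (cmod x) \<le> g (cmod z) + \<omega>" if "x \<in> ball \<eta> \<delta>" for x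
    proof -
      have "cmod (x - \<eta>) < \<delta>" using that by (simp add: dist_norm norm_minus_commute)
      then have xz: "cmod (x - z) < 3 * \<delta>" using \<eta>(1) norm_triangle_ineq[of "x - \<eta>" "\<eta> - z"] by simp
      have "\<bar>cmod x - cmod z\<bar> < 3 * \<delta>" using norm_triangle_ineq3[of x z] xz by linarith
      then have "dist (g (cmod x)) (g (cmod z)) < \<omega>"
        using False \<delta>' by (intro d(2)) (auto simp: dist_real_def)
      then show ?thesis by (simp add: dist_real_def)
    qed
    then show ?thesis using \<eta> by blast
  qed
  ultimately show ?thesis by blast
qed

text \<open>
  The mean of the potential over a disc.
\<close>

definition disc_potential :: "real \<Rightarrow> complex \<Rightarrow> real" where
  "disc_potential \<delta> \<eta> = (\<integral>x. g (cmod x) \<partial>disc_law \<delta> \<eta>)"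

text \<open>
  The energy of a configuration after each point has been replaced by the uniform distribution on a
  disc around it; the self-interaction of the discs is left out.
\<close>

definition smeared_energy :: "real \<Rightarrow> nat \<Rightarrow> (nat \<Rightarrow> complex) \<Rightarrow> real" where
  "smeared_energy \<delta> n \<eta> = \<beta> * (\<Sum>j<n. \<Sum>i<j. disc_interaction \<delta> (\<eta> i) (\<eta> j)) + real n * (\<Sum>k<n. disc_potential \<delta> (\<eta> k))"

lemma integrable_g_disc:
  assumes "\<delta> > 0"
  shows "integrable (disc_law \<delta> \<eta>) (\<lambda>x. g (cmod x))"
proof -
  interpret prob_space "disc_law \<delta> \<eta>" by (rule prob_space_disc_law[OF assms])
  show ?thesis
  proof (rule integrable_const_bound)
    show "AE x in disc_law \<delta> \<eta>. norm (g (cmod x)) \<le> g (cmod \<eta> + \<delta>)"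
      using AE_disc_law[OF assms, of \<eta>]
    proof eventually_elim
      case (elim x)
      have "cmod x \<le> cmod \<eta> + \<delta>"
        using elim norm_triangle_ineq[of \<eta> "x - \<eta>"] by (simp add: dist_norm norm_minus_commute)
      then have "g (cmod x) \<le> g (cmod \<eta> + \<delta>)" using g_mono assms by (auto simp: mono_on_def)
      then show ?case using g_nonneg[of "cmod x"] by simp
    qed
  qed measurable
qed

text \<open>
  The central estimate. At a suitable radius, which depends neither on the number of points nor on
  the configuration, smearing a configuration outside the hole over discs outside the hole increases
  the energy by a factor \<open>1 + \<kappa>\<close> and an error of at most \<open>\<kappa> * C * n\<^sup>2\<close>.
\<close>

lemma smearing:
  "\<exists>C\<ge>0. \<forall>\<kappa>>0. \<exists>\<delta>. 0 < \<delta> \<and> \<delta> < 1 \<and>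
    (\<forall>n z. inj_on z {..<n} \<longrightarrow> (\<forall>k<n. z k \<notin> U) \<longrightarrow>
      (\<exists>\<eta>. (\<forall>k<n. ball (\<eta> k) \<delta> \<subseteq> - U) \<and> smeared_energy \<delta> n \<eta> \<le> (1 + \<kappa>) * Q n z + \<kappa> * C * (real n)\<^sup>2))"
proof -
  obtain C where C: "C \<ge> 0"
    and C': "\<And>n z. real n * \<beta> * (\<Sum>k<n. ln (1 + cmod (z k))) \<le> Q n z + C * (real n)\<^sup>2"
    using gas_energy_lower_bounds by (elim exE conjE) (rule that, auto)
  show ?thesis
  proof (rule exI[of _ "(C + \<beta>) / 2 + 1"], intro conjI allI impI)
    show "0 \<le> (C + \<beta>) / 2 + 1" using C \<beta>_pos by simp
    fix \<kappa> :: real assume "\<kappa> > 0"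
    obtain \<delta>1 where \<delta>1: "\<delta>1 > 0" "\<And>\<delta> z. \<lbrakk>0 < \<delta>; \<delta> \<le> \<delta>1; z \<notin> U\<rbrakk> \<Longrightarrow>
      \<exists>\<eta>. cmod (\<eta> - z) \<le> 2 * \<delta> \<and> ball \<eta> \<delta> \<subseteq> - U \<and> (\<forall>x\<in>ball \<eta> \<delta>. g (cmod x) \<le> g (cmod z) + \<kappa>)"
      using exists_disc_outside_hole[OF \<open>\<kappa> > 0\<close>] by (elim exE conjE) (rule that, auto)
    define k where "k = \<kappa> / 2"
    have "k > 0" using \<open>\<kappa> > 0\<close> by (simp add: k_def)
    obtain \<delta>2 where \<delta>2: "\<delta>2 > 0" "\<And>\<delta> z w \<eta> \<xi>. \<lbrakk>0 < \<delta>; \<delta> \<le> \<delta>2; z \<noteq> w; cmod (\<eta> - z) \<le> 2 * \<delta>; cmod (\<xi> - w) \<le> 2 * \<delta>\<rbrakk> \<Longrightarrow>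
      disc_interaction \<delta> \<eta> \<xi> \<le> (1 + k) * logk z w + k * (ln (1 + cmod z) + ln (1 + cmod w)) + k"
      using disc_interaction_comparison[OF \<open>k > 0\<close>] by (elim exE conjE) (rule that, auto)
    define \<delta> where "\<delta> = min (1/2) (min \<delta>1 \<delta>2)"
    have \<delta>: "0 < \<delta>" "\<delta> < 1" "\<delta> \<le> \<delta>1" "\<delta> \<le> \<delta>2" using \<delta>1(1) \<delta>2(1) by (auto simp: \<delta>_def)
    have "\<exists>\<eta>. (\<forall>k<n. ball (\<eta> k) \<delta> \<subseteq> - U) \<and> smeared_energy \<delta> n \<eta> \<le> (1 + \<kappa>) * Q n z + \<kappa> * ((C + \<beta>) / 2 + 1) * (real n)\<^sup>2"
      if inj: "inj_on z {..<n}" and zU: "\<forall>k<n. z k \<notin> U" for n and z :: "nat \<Rightarrow> complex"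
    proof -
      have "\<exists>\<eta>. \<forall>k<n. cmod (\<eta> k - z k) \<le> 2 * \<delta> \<and> ball (\<eta> k) \<delta> \<subseteq> - U \<and> (\<forall>x\<in>ball (\<eta> k) \<delta>. g (cmod x) \<le> g (cmod (z k)) + \<kappa>)"
        using \<delta>1(2)[OF \<delta>(1,3)] zU by (intro choice) blast
      then obtain \<eta> where \<eta>: "\<And>k. k < n \<Longrightarrow> cmod (\<eta> k - z k) \<le> 2 * \<delta>" "\<And>k. k < n \<Longrightarrow> ball (\<eta> k) \<delta> \<subseteq> - U"
        "\<And>k x. k < n \<Longrightarrow> x \<in> ball (\<eta> k) \<delta> \<Longrightarrow> g (cmod x) \<le> g (cmod (z k)) + \<kappa>" by blast
      define l where "l k = ln (1 + cmod (z k))" for k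
      have l0: "l k \<ge> 0" for k by (simp add: l_def)
      define S where "S = (\<Sum>j<n. \<Sum>i<j. logk (z i) (z j))"
      define G where "G = (\<Sum>k<n. g (cmod (z k)))"
      have "(\<Sum>j<n. \<Sum>i<j. disc_interaction \<delta> (\<eta> i) (\<eta> j))
        \<le> (\<Sum>j<n. \<Sum>i<j. (1 + k) * logk (z i) (z j) + k * (l i + l j) + k)"
      proof (intro sum_mono)
        fix i j assume ij: "j \<in> {..<n}" "i \<in> {..<j}"
        then have "z i \<noteq> z j" using inj by (auto dest: inj_onD)
        then show "disc_interaction \<delta> (\<eta> i) (\<eta> j) \<le> (1 + k) * logk (z i) (z j) + k * (l i + l j) + k"
          unfolding l_def using ij \<eta>(1) by (intro \<delta>2(2)[OF \<delta>(1,4)]) auto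
      qed
      also have "\<dots> = (1 + k) * S + k * (\<Sum>j<n. \<Sum>i<j. l i + l j) + k * (\<Sum>j<n. real j)"
        unfolding S_def sum_distrib_left by (simp add: sum.distrib mult.commute)
      also have "\<dots> \<le> (1 + k) * S + k * (real n * (\<Sum>i<n. l i)) + k * (real n)\<^sup>2"
      proof -
        have "(\<Sum>j<n. real j) \<le> (\<Sum>j<n. real n)" by (intro sum_mono) auto
        then have "(\<Sum>j<n. real j) \<le> (real n)\<^sup>2" by (simp add: power2_eq_square)
        then show ?thesis using pair_sum_le[of l n, OF l0] \<open>k > 0\<close> by (intro add_mono mult_left_mono) auto
      qed
      finally have "\<beta> * (\<Sum>j<n. \<Sum>i<j. disc_interaction \<delta> (\<eta> i) (\<eta> j))
         \<le> \<beta> * ((1 + k) * S + k * (real n * (\<Sum>i<n. l i)) + k * (real n)\<^sup>2)"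
        using \<beta>_pos by (intro mult_left_mono) auto
      also have "\<dots> = (1 + k) * (\<beta> * S) + k * (real n * \<beta> * (\<Sum>i<n. l i)) + k * \<beta> * (real n)\<^sup>2"
        by (simp add: algebra_simps)
      also have "\<dots> \<le> (1 + k) * (\<beta> * S) + k * (Q n z + C * (real n)\<^sup>2) + k * \<beta> * (real n)\<^sup>2"
        using C'[of n z] \<open>k > 0\<close> \<beta>_pos unfolding l_def by (intro add_mono mult_left_mono) auto
      finally have 1: "\<beta> * (\<Sum>j<n. \<Sum>i<j. disc_interaction \<delta> (\<eta> i) (\<eta> j))
         \<le> (1 + k) * (\<beta> * S) + k * (Q n z + C * (real n)\<^sup>2) + k * \<beta> * (real n)\<^sup>2" .
      have pot: "disc_potential \<delta> (\<eta> j) \<le> g (cmod (z j)) + \<kappa>" if "j < n" for j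
      proof -
        interpret prob_space "disc_law \<delta> (\<eta> j)" by (rule prob_space_disc_law[OF \<delta>(1)])
        show ?thesis unfolding disc_potential_def
        proof (rule integral_le_const[OF integrable_g_disc[OF \<delta>(1)]])
          show "AE x in disc_law \<delta> (\<eta> j). g (cmod x) \<le> g (cmod (z j)) + \<kappa>"
            using AE_disc_law[OF \<delta>(1), of "\<eta> j"] by eventually_elim (rule \<eta>(3)[OF that])
        qed
      qed
      have "(\<Sum>j<n. disc_potential \<delta> (\<eta> j)) \<le> (\<Sum>j<n. g (cmod (z j)) + \<kappa>)"
        by (intro sum_mono pot) auto
      also have "\<dots> = G + real n * \<kappa>" by (simp add: G_def sum.distrib)
      finally have "real n * (\<Sum>j<n. disc_potential \<delta> (\<eta> j)) \<le> real n * (G + real n * \<kappa>)"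
        by (intro mult_left_mono) auto
      also have "\<dots> \<le> (1 + k) * (real n * G) + \<kappa> * (real n)\<^sup>2"
      proof -
        have "G \<ge> 0" unfolding G_def by (intro sum_nonneg g_nonneg) auto
        then have "k * (real n * G) \<ge> 0" using \<open>k > 0\<close> by simp
        then show ?thesis by (simp add: algebra_simps power2_eq_square)
      qed
      finally have 2: "real n * (\<Sum>j<n. disc_potential \<delta> (\<eta> j)) \<le> (1 + k) * (real n * G) + \<kappa> * (real n)\<^sup>2" .
      have Q: "Q n z = \<beta> * S + real n * G" by (simp add: gas_energy_def S_def G_def)
      have "smeared_energy \<delta> n \<eta> \<le> (1 + \<kappa>) * Q n z + \<kappa> * ((C + \<beta>) / 2 + 1) * (real n)\<^sup>2"
        using add_mono[OF 1 2] unfolding smeared_energy_def Q k_def by (simp add: algebra_simps add_divide_distrib)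
      then show ?thesis using \<eta>(2) by blast
    qed
    then show "\<exists>\<delta>. 0 < \<delta> \<and> \<delta> < 1 \<and>
    (\<forall>n z. inj_on z {..<n} \<longrightarrow> (\<forall>k<n. z k \<notin> U) \<longrightarrow>
      (\<exists>\<eta>. (\<forall>k<n. ball (\<eta> k) \<delta> \<subseteq> - U) \<and> smeared_energy \<delta> n \<eta> \<le> (1 + \<kappa>) * Q n z + \<kappa> * ((C + \<beta>) / 2 + 1) * (real n)\<^sup>2))"
      using \<delta>(1,2) by blast
  qed
qed

end

section \<open>Smeared configurations as competitors for the minimal energy\<close>

lemma log_kernel_eq_logk: "z \<noteq> w \<Longrightarrow> log_kernel z w = ereal (logk z w)"
  by (simp add: log_kernel_def logk_def ln_div)

lemma ereal_integral_log_kernel: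
  fixes \<mu> \<nu> :: "complex measure"
  assumes "AE p in \<mu> \<Otimes>\<^sub>M \<nu>. fst p \<noteq> snd p"
    and int: "integrable (\<mu> \<Otimes>\<^sub>M \<nu>) (\<lambda>p. logk (fst p) (snd p))"
  shows "ereal_integral (\<mu> \<Otimes>\<^sub>M \<nu>) (\<lambda>(z, w). log_kernel z w) = ereal (\<integral>p. logk (fst p) (snd p) \<partial>(\<mu> \<Otimes>\<^sub>M \<nu>))"
proof -
  let ?M = "\<mu> \<Otimes>\<^sub>M \<nu>"
  define P where "P = (\<integral>\<^sup>+p. ennreal (logk (fst p) (snd p)) \<partial>?M)"
  define N where "N = (\<integral>\<^sup>+p. ennreal (- logk (fst p) (snd p)) \<partial>?M)"
  have "P < \<infinity>" "N < \<infinity>"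
    using int unfolding P_def N_def real_integrable_def by (auto simp: less_top)
  have "(\<integral>\<^sup>+p. e2ennreal ((\<lambda>(z, w). log_kernel z w) p) \<partial>?M) = P"
    unfolding P_def
  proof (rule nn_integral_cong_AE)
    show "AE p in ?M. e2ennreal ((\<lambda>(z, w). log_kernel z w) p) = ennreal (logk (fst p) (snd p))"
      using assms(1) by eventually_elim (auto simp: log_kernel_eq_logk split_beta)
  qed
  moreover have "(\<integral>\<^sup>+p. e2ennreal (- (\<lambda>(z, w). log_kernel z w) p) \<partial>?M) = N"
    unfolding N_def
  proof (rule nn_integral_cong_AE)
    show "AE p in ?M. e2ennreal (- (\<lambda>(z, w). log_kernel z w) p) = ennreal (- logk (fst p) (snd p))"
      using assms(1) by eventually_elim (auto simp: log_kernel_eq_logk split_beta)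
  qed
  moreover have "enn2ereal P - enn2ereal N = ereal (enn2real P - enn2real N)"
    using \<open>P < \<infinity>\<close> \<open>N < \<infinity>\<close> by (cases P; cases N) (auto simp: enn2ereal_ennreal)
  ultimately show ?thesis
    unfolding ereal_integral_def real_lebesgue_integral_def[OF int] P_def N_def by simp
qed

lemma measure_support_subset:
  assumes "sets \<mu> = sets borel" and "closed K" and "emeasure \<mu> (- K) = 0"
  shows "measure_support \<mu> \<subseteq> K"
proof
  fix z assume z: "z \<in> measure_support \<mu>"
  show "z \<in> K"
  proof (rule ccontr)
    assume "z \<notin> K"
    then obtain e where "e > 0" "ball z e \<subseteq> - K"
      using \<open>closed K\<close> open_contains_ball[of "- K"] by (meson ComplI open_Compl)
    moreover have "- K \<in> sets \<mu>" unfolding assms(1) using \<open>closed K\<close> by (intro borel_open open_Compl)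
    ultimately have "emeasure \<mu> (ball z e) \<le> emeasure \<mu> (- K)"
      by (intro emeasure_mono)
    moreover have "emeasure \<mu> (ball z e) > 0" using z \<open>e > 0\<close> unfolding measure_support_def by blast
    ultimately show False using assms(3) by simp
  qed
qed

lemma closed_measure_support:
  assumes "sets \<mu> = sets borel"
  shows "closed (measure_support \<mu>)"
  unfolding closed_def open_contains_ball
proof
  fix z assume "z \<in> - measure_support \<mu>"
  then obtain e where e: "e > 0" "emeasure \<mu> (ball z e) = 0"
    unfolding measure_support_def by (auto simp: zero_less_iff_neq_zero)
  have "ball z e \<subseteq> - measure_support \<mu>"
  proof
    fix w assume w: "w \<in> ball z e"
    have "ball w (e - dist z w) \<subseteq> ball z e"
    proof
      fix x assume "x \<in> ball w (e - dist z w)"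
      then show "x \<in> ball z e" using dist_triangle[of z x w] by simp
    qed
    moreover have "ball z e \<in> sets \<mu>" unfolding assms(1) by (intro borel_open open_ball)
    ultimately have "emeasure \<mu> (ball w (e - dist z w)) \<le> emeasure \<mu> (ball z e)"
      by (intro emeasure_mono)
    then have "emeasure \<mu> (ball w (e - dist z w)) = 0" using e by simp
    moreover have "e - dist z w > 0" using w by simp
    ultimately show "w \<in> - measure_support \<mu>"
      unfolding measure_support_def Compl_iff mem_Collect_eq by (metis less_irrefl)
  qed
  then show "\<exists>e>0. ball z e \<subseteq> - measure_support \<mu>" using e by blast
qed

lemma disc_pair_density:
  assumes "\<delta> > 0"
  shows "disc_law \<delta> \<eta> \<Otimes>\<^sub>M disc_law \<delta> \<xi> =
    density (lborel \<Otimes>\<^sub>M lborel) (\<lambda>p. ennreal (disc_density \<delta> \<eta> (fst p) * disc_density \<delta> \<xi> (snd p)))"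
proof -
  have "sigma_finite_measure (disc_law \<delta> \<xi>)"
    using prob_space_disc_law[OF assms] by (simp add: prob_space_imp_sigma_finite)
  then show ?thesis
    unfolding disc_law_def by (subst pair_measure_density)
      (auto intro!: density_cong lborel.sigma_finite_measure_axioms simp: ennreal_mult disc_density_nonneg split_beta)
qed

lemma disc_interaction_alt:
  "disc_interaction \<delta> \<eta> \<xi> = (\<integral>p. logk (fst p) (snd p) \<partial>(disc_law \<delta> \<eta> \<Otimes>\<^sub>M disc_law \<delta> \<xi>))"
  unfolding disc_interaction_def case_prod_beta ..

lemma disc_interaction_commute:
  assumes "\<delta> > 0"
  shows "disc_interaction \<delta> \<eta> \<xi> = disc_interaction \<delta> \<xi> \<eta>"
proof -
  let ?A = "disc_law \<delta> \<eta>" and ?B = "disc_law \<delta> \<xi>"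
  interpret A: prob_space ?A by (rule prob_space_disc_law[OF assms(1)])
  interpret B: prob_space ?B by (rule prob_space_disc_law[OF assms(1)])
  interpret AB: pair_prob_space ?A ?B ..
  have "disc_interaction \<delta> \<eta> \<xi> = (\<integral>(x,y). (\<lambda>(x, y). logk x y) (y,x) \<partial>(?B \<Otimes>\<^sub>M ?A))"
    unfolding disc_interaction_def by (subst AB.integral_product_swap) (auto simp: split_beta)
  also have "\<dots> = disc_interaction \<delta> \<xi> \<eta>"
    unfolding disc_interaction_def by (simp add: logk_commute)
  finally show ?thesis .
qed

lemma sum_square_symmetric:
  fixes a :: "nat \<Rightarrow> nat \<Rightarrow> real"
  assumes "\<And>i j. a i j = a j i"
  shows "(\<Sum>i<n. \<Sum>j<n. a i j) = 2 * (\<Sum>j<n. \<Sum>i<j. a i j) + (\<Sum>i<n. a i i)"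
proof (induction n)
  case (Suc n)
  have "(\<Sum>i<Suc n. \<Sum>j<Suc n. a i j) = (\<Sum>i<n. \<Sum>j<n. a i j) + (\<Sum>i<n. a i n) + (\<Sum>j<n. a n j) + a n n"
    by (simp add: sum.distrib)
  moreover have "(\<Sum>j<n. a n j) = (\<Sum>i<n. a i n)" using assms by simp
  ultimately show ?case using Suc by simp
qed simp

text \<open>
  Density and law of the average of the uniform distributions on the discs with centres
  \<open>\<eta> 0, \<dots>, \<eta> (n - 1)\<close>: the smeared empirical measure of a configuration.
\<close>

definition smeared_density :: "real \<Rightarrow> nat \<Rightarrow> (nat \<Rightarrow> complex) \<Rightarrow> complex \<Rightarrow> real" where
  "smeared_density \<delta> n \<eta> x = (\<Sum>k<n. disc_density \<delta> (\<eta> k) x) / real n"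

definition smeared_measure :: "real \<Rightarrow> nat \<Rightarrow> (nat \<Rightarrow> complex) \<Rightarrow> complex measure" where
  "smeared_measure \<delta> n \<eta> = density lborel (\<lambda>x. ennreal (smeared_density \<delta> n \<eta> x))"

lemma smeared_density_nonneg: "smeared_density \<delta> n \<eta> x \<ge> 0"
  unfolding smeared_density_def by (simp add: sum_nonneg disc_density_nonneg)

lemma smeared_density_measurable [measurable]: "smeared_density \<delta> n \<eta> \<in> borel_measurable borel"
  unfolding smeared_density_def by measurable

lemma sets_smeared_measure [simp, measurable_cong]: "sets (smeared_measure \<delta> n \<eta>) = sets borel"
  unfolding smeared_measure_def by simp

lemma emeasure_smeared_measure:
  assumes "n > 0" and [measurable]: "A \<in> sets borel"
  shows "emeasure (smeared_measure \<delta> n \<eta>) A = ennreal (1 / real n) * (\<Sum>k<n. emeasure (disc_law \<delta> (\<eta> k)) A)"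
proof -
  have "emeasure (smeared_measure \<delta> n \<eta>) A = (\<integral>\<^sup>+x. ennreal (1 / real n) * (\<Sum>k<n. ennreal (disc_density \<delta> (\<eta> k) x) * indicator A x) \<partial>lborel)"
    unfolding smeared_measure_def
  proof (subst emeasure_density, measurable, intro nn_integral_cong)
    fix x
    have "ennreal (smeared_density \<delta> n \<eta> x) = ennreal (1 / real n) * (\<Sum>k<n. ennreal (disc_density \<delta> (\<eta> k) x))"
      unfolding smeared_density_def
      by (subst sum_ennreal) (auto simp: disc_density_nonneg ennreal_mult[symmetric] sum_nonneg)
    then show "ennreal (smeared_density \<delta> n \<eta> x) * indicator A x
      = ennreal (1 / real n) * (\<Sum>k<n. ennreal (disc_density \<delta> (\<eta> k) x) * indicator A x)"
      by (simp add: sum_distrib_right mult.assoc)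
  qed
  also have "\<dots> = ennreal (1 / real n) * (\<Sum>k<n. emeasure (disc_law \<delta> (\<eta> k)) A)"
    unfolding disc_law_def
    by (subst nn_integral_cmult, measurable, subst nn_integral_sum, measurable) (simp add: emeasure_density)
  finally show ?thesis .
qed

lemma prob_space_smeared_measure:
  assumes "\<delta> > 0" "n > 0"
  shows "prob_space (smeared_measure \<delta> n \<eta>)"
proof
  have "emeasure (disc_law \<delta> \<xi>) UNIV = 1" for \<xi>
    using prob_space.emeasure_space_1[OF prob_space_disc_law[OF assms(1)], of \<xi>] by simp
  then have "emeasure (smeared_measure \<delta> n \<eta>) UNIV = ennreal (1 / real n) * ennreal (real n)"
    using assms by (simp add: emeasure_smeared_measure ennreal_of_nat_eq_real_of_nat)
  also have "\<dots> = 1" using assms by (subst ennreal_mult[symmetric]) auto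
  finally show "emeasure (smeared_measure \<delta> n \<eta>) (space (smeared_measure \<delta> n \<eta>)) = 1"
    unfolding smeared_measure_def by simp
qed

lemma smeared_measure_null:
  assumes "\<delta> > 0" "n > 0" and [measurable]: "A \<in> sets borel" and "\<And>k. k < n \<Longrightarrow> A \<inter> ball (\<eta> k) \<delta> = {}"
  shows "emeasure (smeared_measure \<delta> n \<eta>) A = 0"
  using assms by (simp add: emeasure_smeared_measure emeasure_disc_law)

lemma smeared_measure_compact:
  assumes "\<delta> > 0" "n > 0" "open U" and balls: "\<And>k. k < n \<Longrightarrow> ball (\<eta> k) \<delta> \<subseteq> - U"
  shows "smeared_measure \<delta> n \<eta> \<in> compact_prob_measures (- U)"
proof -
  let ?\<mu> = "smeared_measure \<delta> n \<eta>"
  define K where "K = (\<Union>k<n. cball (\<eta> k) \<delta>)"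
  have "compact K" unfolding K_def by (intro compact_UN) auto
  have in_K: "measure_support ?\<mu> \<subseteq> K"
  proof (rule measure_support_subset)
    have "- K \<in> sets borel" using \<open>compact K\<close> by (auto simp: compact_imp_closed)
    moreover have "- K \<inter> ball (\<eta> k) \<delta> = {}" if "k < n" for k
      unfolding K_def using that ball_subset_cball[of "\<eta> k" \<delta>] by blast
    ultimately show "emeasure ?\<mu> (- K) = 0"
      using assms(1,2) by (intro smeared_measure_null)
  qed (auto simp: compact_imp_closed \<open>compact K\<close>)
  have "measure_support ?\<mu> \<subseteq> - U"
  proof (rule measure_support_subset)
    show "emeasure ?\<mu> (- (- U)) = 0"
      using assms balls by (intro smeared_measure_null) auto
  qed (use assms in auto)
  moreover have "compact (measure_support ?\<mu>)"
    using compact_Int_closed[OF \<open>compact K\<close> closed_measure_support[of ?\<mu>]] in_K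
    by (simp add: Int_absorb1)
  ultimately show ?thesis
    unfolding compact_prob_measures_def using prob_space_smeared_measure[OF assms(1,2)] by simp
qed

lemma integral_smeared:
  assumes "n > 0" and h [measurable]: "h \<in> borel_measurable borel"
    and int: "\<And>k. k < n \<Longrightarrow> integrable (disc_law \<delta> (\<eta> k)) h"
  shows "integral\<^sup>L (smeared_measure \<delta> n \<eta>) h = (\<Sum>k<n. integral\<^sup>L (disc_law \<delta> (\<eta> k)) h) / real n"
proof -
  have int': "integrable lborel (\<lambda>x. disc_density \<delta> (\<eta> k) x * h x)" if "k < n" for k
    using int[OF that] unfolding disc_law_def by (simp add: integrable_density disc_density_nonneg)
  have eq: "smeared_density \<delta> n \<eta> x * h x = (\<Sum>k<n. disc_density \<delta> (\<eta> k) x * h x) / real n" for x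
    by (simp add: smeared_density_def sum_distrib_right)
  show "integral\<^sup>L (smeared_measure \<delta> n \<eta>) h = (\<Sum>k<n. integral\<^sup>L (disc_law \<delta> (\<eta> k)) h) / real n"
    unfolding smeared_measure_def disc_law_def using int'
    by (simp add: integral_density smeared_density_nonneg disc_density_nonneg eq)
qed

lemma
  assumes "n > 0" "\<delta> > 0" and h [measurable]: "h \<in> borel_measurable (borel \<Otimes>\<^sub>M borel)"
    and int: "\<And>i j. i < n \<Longrightarrow> j < n \<Longrightarrow> integrable (disc_law \<delta> (\<eta> i) \<Otimes>\<^sub>M disc_law \<delta> (\<eta> j)) h"
  shows integrable_smeared_pair: "integrable (smeared_measure \<delta> n \<eta> \<Otimes>\<^sub>M smeared_measure \<delta> n \<eta>) h"
    and integral_smeared_pair: "integral\<^sup>L (smeared_measure \<delta> n \<eta> \<Otimes>\<^sub>M smeared_measure \<delta> n \<eta>) h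
      = (\<Sum>i<n. \<Sum>j<n. integral\<^sup>L (disc_law \<delta> (\<eta> i) \<Otimes>\<^sub>M disc_law \<delta> (\<eta> j)) h) / (real n)\<^sup>2"
proof -
  let ?f = "smeared_density \<delta> n \<eta>"
  let ?d = "\<lambda>k. disc_density \<delta> (\<eta> k)"
  have [measurable]: "h \<in> borel_measurable (lborel \<Otimes>\<^sub>M lborel)"
    by measurable
  have "sigma_finite_measure (smeared_measure \<delta> n \<eta>)"
    using prob_space_smeared_measure[OF assms(2,1)] by (simp add: prob_space_imp_sigma_finite)
  then have dens: "smeared_measure \<delta> n \<eta> \<Otimes>\<^sub>M smeared_measure \<delta> n \<eta> =
     density (lborel \<Otimes>\<^sub>M lborel) (\<lambda>p. ennreal (?f (fst p) * ?f (snd p)))"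
    unfolding smeared_measure_def by (subst pair_measure_density)
      (auto intro!: density_cong lborel.sigma_finite_measure_axioms simp: ennreal_mult smeared_density_nonneg split_beta)
  have int': "integrable (lborel \<Otimes>\<^sub>M lborel) (\<lambda>p. (?d i (fst p) * ?d j (snd p)) * h p)" if "i < n" "j < n" for i j
    using int[OF that] unfolding disc_pair_density[OF assms(2)]
    by (subst (asm) integrable_density) (auto simp: disc_density_nonneg)
  have eq: "(?f (fst p) * ?f (snd p)) * h p = (\<Sum>i<n. \<Sum>j<n. (?d i (fst p) * ?d j (snd p)) * h p) / (real n)\<^sup>2" for p
  proof -
    have factor: "(a / c * (b / c)) * y = (a * b * y) / c\<^sup>2" for a b c y :: real
      by (simp add: power2_eq_square)
    show ?thesis unfolding smeared_density_def factor
      unfolding sum_product unfolding sum_distrib_right ..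
  qed
  show "integrable (smeared_measure \<delta> n \<eta> \<Otimes>\<^sub>M smeared_measure \<delta> n \<eta>) h"
    unfolding dens
    by (subst integrable_density) (auto simp: smeared_density_nonneg eq
        intro!: int' Bochner_Integration.integrable_divide Bochner_Integration.integrable_sum)
  have "integral\<^sup>L (smeared_measure \<delta> n \<eta> \<Otimes>\<^sub>M smeared_measure \<delta> n \<eta>) h
    = (\<integral>p. (\<Sum>i<n. \<Sum>j<n. (?d i (fst p) * ?d j (snd p)) * h p) / (real n)\<^sup>2 \<partial>(lborel \<Otimes>\<^sub>M lborel))"
    unfolding dens
    by (subst integral_density) (auto simp: smeared_density_nonneg eq)
  also have "\<dots> = (\<Sum>i<n. \<Sum>j<n. \<integral>p. (?d i (fst p) * ?d j (snd p)) * h p \<partial>(lborel \<Otimes>\<^sub>M lborel)) / (real n)\<^sup>2"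
  proof -
    have "(\<integral>p. (\<Sum>i<n. \<Sum>j<n. (?d i (fst p) * ?d j (snd p)) * h p) \<partial>(lborel \<Otimes>\<^sub>M lborel))
      = (\<Sum>i<n. \<integral>p. (\<Sum>j<n. (?d i (fst p) * ?d j (snd p)) * h p) \<partial>(lborel \<Otimes>\<^sub>M lborel))"
      by (intro Bochner_Integration.integral_sum Bochner_Integration.integrable_sum int') auto
    also have "\<dots> = (\<Sum>i<n. \<Sum>j<n. \<integral>p. (?d i (fst p) * ?d j (snd p)) * h p \<partial>(lborel \<Otimes>\<^sub>M lborel))"
      by (intro sum.cong refl Bochner_Integration.integral_sum int') auto
    finally show ?thesis by simp
  qed
  also have "\<dots> = (\<Sum>i<n. \<Sum>j<n. integral\<^sup>L (disc_law \<delta> (\<eta> i) \<Otimes>\<^sub>M disc_law \<delta> (\<eta> j)) h) / (real n)\<^sup>2"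
    unfolding disc_pair_density[OF assms(2)]
    by (subst integral_density) (auto simp: disc_density_nonneg)
  finally show "integral\<^sup>L (smeared_measure \<delta> n \<eta> \<Otimes>\<^sub>M smeared_measure \<delta> n \<eta>) h
      = (\<Sum>i<n. \<Sum>j<n. integral\<^sup>L (disc_law \<delta> (\<eta> i) \<Otimes>\<^sub>M disc_law \<delta> (\<eta> j)) h) / (real n)\<^sup>2" .
qed

lemma AE_density_pair_distinct:
  fixes f h :: "complex \<Rightarrow> ennreal"
  assumes [measurable]: "f \<in> borel_measurable borel" "h \<in> borel_measurable borel"
    and "prob_space (density lborel f)" "prob_space (density lborel h)"
  shows "AE p in density lborel f \<Otimes>\<^sub>M density lborel h. fst p \<noteq> snd p"
proof -
  interpret F: prob_space "density lborel f" by fact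
  interpret H: prob_space "density lborel h" by fact
  interpret FH: pair_prob_space "density lborel f" "density lborel h" ..
  show ?thesis
  proof (rule FH.AE_pair_measure)
    have "AE y in density lborel h. x \<noteq> y" for x
      using AE_lborel_singleton[of x] by (subst AE_density) (auto elim: eventually_mono)
    then show "AE x in density lborel f. AE y in density lborel h. fst (x, y) \<noteq> snd (x, y)" by simp
  qed measurable
qed

context gas_with_hole
begin

text \<open>
  Unlike \<open>smeared_energy\<close>, the energy of the smeared empirical measure contains the
  self-interaction of the \<open>n\<close> discs, which is only of order \<open>n\<close> at a fixed radius.
\<close>

lemma smeared_measure_energy:
  assumes "n > 0" "0 < \<delta>" "\<delta> < 1" and balls: "\<And>k. k < n \<Longrightarrow> ball (\<eta> k) \<delta> \<subseteq> - U"
  shows "\<exists>e. min_energy g \<beta> U \<le> ereal e \<and>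
    \<beta> / 2 * (real n)\<^sup>2 * e \<le> smeared_energy \<delta> n \<eta> + real n * (\<beta> / 2 * (ln (1 / \<delta>) + 2))"
proof -
  let ?\<mu> = "smeared_measure \<delta> n \<eta>"
  let ?L = "\<lambda>i j. disc_interaction \<delta> (\<eta> i) (\<eta> j)"
  have ps: "prob_space ?\<mu>" by (rule prob_space_smeared_measure[OF assms(2,1)])
  have ae: "AE p in ?\<mu> \<Otimes>\<^sub>M ?\<mu>. fst p \<noteq> snd p"
    using ps unfolding smeared_measure_def by (intro AE_density_pair_distinct) auto
  define e where "e = (2 * (\<Sum>j<n. \<Sum>i<j. ?L i j) + (\<Sum>i<n. ?L i i)) / (real n)\<^sup>2
    + 2 / \<beta> * ((\<Sum>k<n. disc_potential \<delta> (\<eta> k)) / real n)"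
  have "(\<integral>p. logk (fst p) (snd p) \<partial>(?\<mu> \<Otimes>\<^sub>M ?\<mu>)) = (\<Sum>i<n. \<Sum>j<n. ?L i j) / (real n)\<^sup>2"
    using assms by (subst integral_smeared_pair)
      (auto intro!: integrable_logk_disc simp: disc_interaction_alt)
  then have "ereal_integral (?\<mu> \<Otimes>\<^sub>M ?\<mu>) (\<lambda>(z, w). log_kernel z w) =
     ereal ((2 * (\<Sum>j<n. \<Sum>i<j. ?L i j) + (\<Sum>i<n. ?L i i)) / (real n)\<^sup>2)"
    using assms disc_interaction_commute[OF assms(2)]
    by (subst ereal_integral_log_kernel[OF ae])
      (auto intro!: integrable_smeared_pair integrable_logk_disc simp: sum_square_symmetric)
  moreover have "(\<integral>z. g (cmod z) \<partial>?\<mu>) = (\<Sum>k<n. disc_potential \<delta> (\<eta> k)) / real n"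
    unfolding disc_potential_def using assms
    by (intro integral_smeared integrable_g_disc) auto
  ultimately have "energy g \<beta> ?\<mu> = ereal e"
    unfolding energy_def e_def by simp
  moreover have "?\<mu> \<in> compact_prob_measures (- U)"
    by (rule smeared_measure_compact[OF assms(2,1) open_U balls])
  ultimately have "min_energy g \<beta> U \<le> ereal e"
    unfolding min_energy_def by (metis INF_lower)
  moreover have "\<beta> / 2 * (real n)\<^sup>2 * e \<le> smeared_energy \<delta> n \<eta> + real n * (\<beta> / 2 * (ln (1 / \<delta>) + 2))"
  proof -
    have "(\<Sum>i<n. ?L i i) \<le> (\<Sum>i<n. ln (1 / \<delta>) + 2)"
      by (intro sum_mono disc_interaction_le assms)
    then have "\<beta> / 2 * (\<Sum>i<n. ?L i i) \<le> \<beta> / 2 * (real n * (ln (1 / \<delta>) + 2))"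
      using \<beta>_pos by (intro mult_left_mono) auto
    moreover have "\<beta> / 2 * (real n)\<^sup>2 * e = smeared_energy \<delta> n \<eta> + \<beta> / 2 * (\<Sum>i<n. ?L i i)"
      unfolding e_def smeared_energy_def using \<open>n > 0\<close> \<beta>_pos
      by (simp add: field_simps power2_eq_square)
    ultimately show ?thesis by (simp add: algebra_simps)
  qed
  ultimately show ?thesis by blast
qed

end

section \<open>Independent points\<close>

lemma distr_PiM_pair:
  assumes "\<And>k. k \<in> I \<Longrightarrow> prob_space (M k)" and ij: "i \<in> I" "j \<in> I" "i \<noteq> j"
  shows "distr (PiM I M) (M i \<Otimes>\<^sub>M M j) (\<lambda>x. (x i, x j)) = M i \<Otimes>\<^sub>M M j"
proof (rule pair_measure_eqI[symmetric])
  show "sigma_finite_measure (M i)" "sigma_finite_measure (M j)"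
    using assms by (auto intro: prob_space_imp_sigma_finite)
  show "sets (M i \<Otimes>\<^sub>M M j) = sets (distr (PiM I M) (M i \<Otimes>\<^sub>M M j) (\<lambda>x. (x i, x j)))" by simp
  have [measurable]: "(\<lambda>x. (x i, x j)) \<in> PiM I M \<rightarrow>\<^sub>M M i \<Otimes>\<^sub>M M j"
    using ij by (intro measurable_Pair measurable_component_singleton)
  fix A B assume AB: "A \<in> sets (M i)" "B \<in> sets (M j)"
  define X where "X = (\<lambda>k. if k = i then A else B)"
  have "emeasure (distr (PiM I M) (M i \<Otimes>\<^sub>M M j) (\<lambda>x. (x i, x j))) (A \<times> B)
     = emeasure (PiM I M) ((\<lambda>x. (x i, x j)) -` (A \<times> B) \<inter> space (PiM I M))"
    using AB by (subst emeasure_distr) auto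
  also have "(\<lambda>x. (x i, x j)) -` (A \<times> B) \<inter> space (PiM I M) = prod_emb I M {i, j} (PiE {i, j} X)"
    using ij by (auto simp: prod_emb_def X_def space_PiM PiE_iff restrict_def extensional_def)
  also have "emeasure (PiM I M) \<dots> = (\<Prod>k\<in>{i, j}. emeasure (M k) (X k))"
    using assms AB by (intro emeasure_PiM_emb) (auto simp: X_def)
  also have "\<dots> = emeasure (M i) A * emeasure (M j) B"
    using ij by (simp add: X_def)
  finally show "emeasure (M i) A * emeasure (M j) B
    = emeasure (distr (PiM I M) (M i \<Otimes>\<^sub>M M j) (\<lambda>x. (x i, x j))) (A \<times> B)" by simp
qed

lemma
  fixes h :: "_ \<Rightarrow> real"
  assumes "\<And>k. k \<in> I \<Longrightarrow> prob_space (M k)" and ij: "i \<in> I" "j \<in> I" "i \<noteq> j"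
    and "integrable (M i \<Otimes>\<^sub>M M j) h"
  shows integrable_PiM_pair: "integrable (PiM I M) (\<lambda>x. h (x i, x j))"
    and integral_PiM_pair: "(\<integral>x. h (x i, x j) \<partial>PiM I M) = integral\<^sup>L (M i \<Otimes>\<^sub>M M j) h"
proof -
  have m [measurable]: "(\<lambda>x. (x i, x j)) \<in> PiM I M \<rightarrow>\<^sub>M M i \<Otimes>\<^sub>M M j"
    using ij by (intro measurable_Pair measurable_component_singleton)
  have h: "h \<in> borel_measurable (M i \<Otimes>\<^sub>M M j)" using assms(5) by auto
  have D: "distr (PiM I M) (M i \<Otimes>\<^sub>M M j) (\<lambda>x. (x i, x j)) = M i \<Otimes>\<^sub>M M j"
    by (rule distr_PiM_pair[OF assms(1) ij])
  show "integrable (PiM I M) (\<lambda>x. h (x i, x j))"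
    by (rule integrable_distr[OF m]) (subst D, rule assms(5))
  show "(\<integral>x. h (x i, x j) \<partial>PiM I M) = integral\<^sup>L (M i \<Otimes>\<^sub>M M j) h"
    using integral_distr[OF m h] unfolding D by simp
qed

lemma
  fixes h :: "_ \<Rightarrow> real"
  assumes "\<And>k. k \<in> I \<Longrightarrow> prob_space (M k)" and i: "i \<in> I" and "integrable (M i) h"
  shows integrable_PiM_component: "integrable (PiM I M) (\<lambda>x. h (x i))"
    and integral_PiM_component: "(\<integral>x. h (x i) \<partial>PiM I M) = integral\<^sup>L (M i) h"
proof -
  have m [measurable]: "(\<lambda>x. x i) \<in> PiM I M \<rightarrow>\<^sub>M M i"
    using i by (intro measurable_component_singleton)
  have h: "h \<in> borel_measurable (M i)" using assms(3) by auto
  have D: "distr (PiM I M) (M i) (\<lambda>x. x i) = M i"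
    by (rule distr_PiM_component[OF assms(1) i])
  show "integrable (PiM I M) (\<lambda>x. h (x i))"
    by (rule integrable_distr[OF m]) (subst D, rule assms(3))
  show "(\<integral>x. h (x i) \<partial>PiM I M) = integral\<^sup>L (M i) h"
    using integral_distr[OF m h] unfolding D by simp
qed

text \<open>
  The mean energy of a configuration of independent random points.
\<close>

lemma
  fixes M :: "nat \<Rightarrow> complex measure"
  assumes prob: "\<And>k. k < n \<Longrightarrow> prob_space (M k)"
    and int: "\<And>i j. i < n \<Longrightarrow> j < n \<Longrightarrow> i \<noteq> j \<Longrightarrow> integrable (M i \<Otimes>\<^sub>M M j) (\<lambda>p. logk (fst p) (snd p))"
    and int_g: "\<And>k. k < n \<Longrightarrow> integrable (M k) (\<lambda>z. g (cmod z))"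
  shows integrable_gas_energy: "integrable (PiM {..<n} M) (gas_energy g \<beta> n)"
    and integral_gas_energy: "integral\<^sup>L (PiM {..<n} M) (gas_energy g \<beta> n)
      = \<beta> * (\<Sum>j<n. \<Sum>i<j. \<integral>p. logk (fst p) (snd p) \<partial>(M i \<Otimes>\<^sub>M M j)) + real n * (\<Sum>k<n. \<integral>z. g (cmod z) \<partial>M k)"
proof -
  let ?P = "PiM {..<n} M"
  have pair: "integrable ?P (\<lambda>x. logk (x i) (x j)) \<and>
     (\<integral>x. logk (x i) (x j) \<partial>?P) = (\<integral>p. logk (fst p) (snd p) \<partial>(M i \<Otimes>\<^sub>M M j))"
    if "i < j" "j < n" for i j
    using integrable_PiM_pair[of "{..<n}" M i j "\<lambda>p. logk (fst p) (snd p)"]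
      integral_PiM_pair[of "{..<n}" M i j "\<lambda>p. logk (fst p) (snd p)"] that prob int[of i j] by simp
  have single: "integrable ?P (\<lambda>x. g (cmod (x k))) \<and> (\<integral>x. g (cmod (x k)) \<partial>?P) = (\<integral>z. g (cmod z) \<partial>M k)"
    if "k < n" for k
    using integrable_PiM_component[of "{..<n}" M k "\<lambda>z. g (cmod z)"]
      integral_PiM_component[of "{..<n}" M k "\<lambda>z. g (cmod z)"] that prob int_g by simp
  have eq: "gas_energy g \<beta> n = (\<lambda>x. \<beta> * (\<Sum>j<n. \<Sum>i<j. logk (x i) (x j)) + real n * (\<Sum>k<n. g (cmod (x k))))"
    by (simp add: fun_eq_iff gas_energy_def)
  have i1: "integrable ?P (\<lambda>x. \<Sum>j<n. \<Sum>i<j. logk (x i) (x j))"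
    using pair by (intro Bochner_Integration.integrable_sum) auto
  have i2: "integrable ?P (\<lambda>x. \<Sum>k<n. g (cmod (x k)))"
    using single by (intro Bochner_Integration.integrable_sum) auto
  show "integrable ?P (gas_energy g \<beta> n)"
    unfolding eq using i1 i2 by (intro Bochner_Integration.integrable_add integrable_mult_right)
  have e1: "(\<integral>x. (\<Sum>j<n. \<Sum>i<j. logk (x i) (x j)) \<partial>?P) = (\<Sum>j<n. \<Sum>i<j. \<integral>p. logk (fst p) (snd p) \<partial>(M i \<Otimes>\<^sub>M M j))"
    using pair by (subst Bochner_Integration.integral_sum)
      (auto intro!: Bochner_Integration.integrable_sum sum.cong simp: Bochner_Integration.integral_sum)
  have e2: "(\<integral>x. (\<Sum>k<n. g (cmod (x k))) \<partial>?P) = (\<Sum>k<n. \<integral>z. g (cmod z) \<partial>M k)"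
    using single by (subst Bochner_Integration.integral_sum) auto
  show "integral\<^sup>L ?P (gas_energy g \<beta> n)
      = \<beta> * (\<Sum>j<n. \<Sum>i<j. \<integral>p. logk (fst p) (snd p) \<partial>(M i \<Otimes>\<^sub>M M j)) + real n * (\<Sum>k<n. \<integral>z. g (cmod z) \<partial>M k)"
    unfolding eq using i1 i2 by (simp add: e1 e2)
qed

lemma AE_PiM_inj_on:
  fixes M :: "nat \<Rightarrow> complex measure"
  assumes prob: "\<And>k. k < n \<Longrightarrow> prob_space (M k)"
    and ae: "\<And>i j. i < n \<Longrightarrow> j < n \<Longrightarrow> i \<noteq> j \<Longrightarrow> AE p in M i \<Otimes>\<^sub>M M j. fst p \<noteq> snd p"
  shows "AE z in PiM {..<n} M. inj_on z {..<n}"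
proof -
  have "AE z in PiM {..<n} M. z i \<noteq> z j" if "i < n" "j < n" "i \<noteq> j" for i j
  proof -
    have m: "(\<lambda>x. (x i, x j)) \<in> PiM {..<n} M \<rightarrow>\<^sub>M M i \<Otimes>\<^sub>M M j"
      using that by (intro measurable_Pair measurable_component_singleton) auto
    have "AE p in distr (PiM {..<n} M) (M i \<Otimes>\<^sub>M M j) (\<lambda>x. (x i, x j)). fst p \<noteq> snd p"
      using that prob ae by (subst distr_PiM_pair) auto
    from AE_distrD[OF m this] show ?thesis by simp
  qed
  then have "AE z in PiM {..<n} M. \<forall>i\<in>{..<n}. \<forall>j\<in>{..<n}. i \<noteq> j \<longrightarrow> z i \<noteq> z j"
    by (intro AE_finite_allI) auto
  then show ?thesis by eventually_elim (auto simp: inj_on_def)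
qed

lemma PiM_disc_law:
  fixes n :: nat
  assumes "\<delta> > 0"
  shows "PiM {..<n} (\<lambda>k. disc_law \<delta> (\<eta> k)) =
    density (PiM {..<n} (\<lambda>k. lborel)) (\<lambda>z. ennreal (\<Prod>k<n. disc_density \<delta> (\<eta> k) (z k)))"
proof (rule sym, rule product_sigma_finite.PiM_eqI)
  interpret L: product_sigma_finite "\<lambda>_::nat. lborel :: complex measure"
    by standard
  show "product_sigma_finite (\<lambda>k. disc_law \<delta> (\<eta> k))"
    unfolding product_sigma_finite_def
    using prob_space_disc_law[OF assms] by (auto intro: prob_space_imp_sigma_finite)
  show "sets (density (PiM {..<n} (\<lambda>k. lborel)) (\<lambda>z. ennreal (\<Prod>k<n. disc_density \<delta> (\<eta> k) (z k)))) =
    sets (PiM {..<n} (\<lambda>k. disc_law \<delta> (\<eta> k)))"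
    unfolding sets_density by (intro sets_PiM_cong) auto
  fix A :: "nat \<Rightarrow> complex set"
  assume "\<And>i. i \<in> {..<n} \<Longrightarrow> A i \<in> sets (disc_law \<delta> (\<eta> i))"
  then have A: "\<And>i. i < n \<Longrightarrow> A i \<in> sets borel" by simp
  then have A_box: "Pi\<^sub>E {..<n} A \<in> sets (PiM {..<n} (\<lambda>k. lborel))"
    by (intro sets_PiM_I_finite) simp_all
  have "emeasure (density (PiM {..<n} (\<lambda>k. lborel)) (\<lambda>z. ennreal (\<Prod>k<n. disc_density \<delta> (\<eta> k) (z k)))) (Pi\<^sub>E {..<n} A)
    = (\<integral>\<^sup>+z. ennreal (\<Prod>k<n. disc_density \<delta> (\<eta> k) (z k)) * indicator (Pi\<^sub>E {..<n} A) z \<partial>PiM {..<n} (\<lambda>k. lborel))"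
    by (rule emeasure_density[OF _ A_box]) measurable
  also have "\<dots> = (\<integral>\<^sup>+z. (\<Prod>k<n. ennreal (disc_density \<delta> (\<eta> k) (z k)) * indicator (A k) (z k)) \<partial>PiM {..<n} (\<lambda>k. lborel))"
  proof (intro nn_integral_cong)
    fix z assume "z \<in> space (PiM {..<n} (\<lambda>k. lborel :: complex measure))"
    then have "indicator (Pi\<^sub>E {..<n} A) z = (\<Prod>k<n. indicator (A k) (z k) :: ennreal)"
      by (auto simp: indicator_def space_PiM PiE_iff)
    then show "ennreal (\<Prod>k<n. disc_density \<delta> (\<eta> k) (z k)) * indicator (Pi\<^sub>E {..<n} A) z
      = (\<Prod>k<n. ennreal (disc_density \<delta> (\<eta> k) (z k)) * indicator (A k) (z k))"
      by (simp add: prod.distrib prod_ennreal disc_density_nonneg)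
  qed
  also have "\<dots> = (\<Prod>k<n. \<integral>\<^sup>+x. ennreal (disc_density \<delta> (\<eta> k) x) * indicator (A k) x \<partial>lborel)"
  proof (rule L.product_nn_integral_prod)
    fix k assume "k \<in> {..<n}"
    then have [measurable]: "A k \<in> sets borel" using A by simp
    show "(\<lambda>x. ennreal (disc_density \<delta> (\<eta> k) x) * indicator (A k) x) \<in> borel_measurable lborel"
      by measurable
  qed simp
  also have "\<dots> = (\<Prod>k<n. emeasure (disc_law \<delta> (\<eta> k)) (A k))"
    using A by (intro prod.cong refl) (simp add: disc_law_def emeasure_density)
  finally show "emeasure (density (PiM {..<n} (\<lambda>k. lborel)) (\<lambda>z. ennreal (\<Prod>k<n. disc_density \<delta> (\<eta> k) (z k)))) (Pi\<^sub>E {..<n} A)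
    = (\<Prod>k<n. emeasure (disc_law \<delta> (\<eta> k)) (A k))" .
qed simp

section \<open>The partition function outside the hole\<close>

text \<open>
  The integral of the weight over the configurations that avoid the hole.
\<close>

definition hole_partition_function :: "(real \<Rightarrow> real) \<Rightarrow> real \<Rightarrow> complex set \<Rightarrow> nat \<Rightarrow> ennreal" where
  "hole_partition_function g \<beta> U n =
     (\<integral>\<^sup>+z. ennreal (gas_weight g \<beta> n z) * indicator {z. \<forall>k<n. z k \<notin> U} z \<partial>(\<Pi>\<^sub>M k\<in>{..<n}. lborel))"

context gas_with_hole
begin

lemma gas_weight_measurable [measurable]:
  "gas_weight g \<beta> n \<in> borel_measurable (\<Pi>\<^sub>M k\<in>{..<n}. lborel)"
proof -
  have [measurable]: "(\<lambda>z. z k) \<in> (\<Pi>\<^sub>M k\<in>{..<n}. lborel) \<rightarrow>\<^sub>M (borel :: complex measure)" if "k < n" for k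
    using measurable_component_singleton[of k "{..<n}" "\<lambda>_. lborel :: complex measure"] that by simp
  have m1: "(\<lambda>z. cmod (z i - z j) powr \<beta>) \<in> borel_measurable (\<Pi>\<^sub>M k\<in>{..<n}. (lborel :: complex measure))"
    if [simp]: "i < n" "j < n" for i j
    by measurable
  have m2: "(\<lambda>z. g (cmod (z k))) \<in> borel_measurable (\<Pi>\<^sub>M k\<in>{..<n}. (lborel :: complex measure))"
    if [simp]: "k < n" for k
    by (rule measurable_compose[OF _ g_cmod_measurable]) measurable
  have "(\<lambda>z. (\<Prod>j<n. \<Prod>i<j. cmod (z i - z j) powr \<beta>) * exp (- real n * (\<Sum>k<n. g (cmod (z k)))))
     \<in> borel_measurable (\<Pi>\<^sub>M k\<in>{..<n}. (lborel :: complex measure))"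
    by (intro borel_measurable_times borel_measurable_prod borel_measurable_const borel_measurable_sum
        measurable_compose[OF _ borel_measurable_exp] m1 m2) auto
  then show ?thesis unfolding gas_weight_def[abs_def] .
qed

text \<open>
  Jensen's inequality for the product of the disc laws, in the form
  \<open>exp (- Q) \<ge> exp (- F) * (1 + F - Q)\<close> with \<open>F\<close> the mean of \<open>Q\<close>.
\<close>

lemma hole_partition_function_ge:
  assumes \<delta>: "0 < \<delta>" "\<delta> < 1" and balls: "\<And>k. k < n \<Longrightarrow> ball (\<eta> k) \<delta> \<subseteq> - U"
  shows "ennreal ((pi * \<delta>\<^sup>2) ^ n * exp (- smeared_energy \<delta> n \<eta>)) \<le> hole_partition_function g \<beta> U n"
proof -
  let ?L = "\<Pi>\<^sub>M k\<in>{..<n}. (lborel :: complex measure)"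
  let ?P = "PiM {..<n} (\<lambda>k. disc_law \<delta> (\<eta> k))"
  let ?F = "smeared_energy \<delta> n \<eta>"
  let ?a = "(pi * \<delta>\<^sup>2) ^ n"
  interpret P: prob_space ?P by (rule prob_space_PiM) (rule prob_space_disc_law[OF \<delta>(1)])
  have int: "integrable ?P (Q n)"
    using integrable_logk_disc[OF \<delta>] integrable_g_disc[OF \<delta>(1)] prob_space_disc_law[OF \<delta>(1)]
    by (intro integrable_gas_energy)
  have E: "integral\<^sup>L ?P (Q n) = ?F"
    using integrable_logk_disc[OF \<delta>] integrable_g_disc[OF \<delta>(1)] prob_space_disc_law[OF \<delta>(1)]
    unfolding smeared_energy_def disc_potential_def disc_interaction_alt
    by (intro integral_gas_energy)
  have inj: "AE z in ?P. inj_on z {..<n}"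
  proof (rule AE_PiM_inj_on[OF prob_space_disc_law[OF \<delta>(1)]])
    show "AE p in disc_law \<delta> (\<eta> i) \<Otimes>\<^sub>M disc_law \<delta> (\<eta> j). fst p \<noteq> snd p" for i j
      using prob_space_disc_law[OF \<delta>(1)] unfolding disc_law_def by (intro AE_density_pair_distinct) auto
  qed
  \<comment> \<open>The tangent line of the exponential at \<open>- F\<close>.\<close>
  define h where "h z = exp (- ?F) * (1 + ?F - Q n z)" for z
  have h_int: "integrable ?P h" unfolding h_def using int by simp
  have "integral\<^sup>L ?P h = exp (- ?F)"
    unfolding h_def using int E by (simp add: P.prob_space)
  moreover have "integral\<^sup>L ?P h \<le> integral\<^sup>L ?P (\<lambda>z. max 0 (h z))"
    using h_int by (intro integral_mono) auto
  ultimately have "ennreal (exp (- ?F)) \<le> ennreal (integral\<^sup>L ?P (\<lambda>z. max 0 (h z)))"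
    by (intro ennreal_leI) simp
  also have "\<dots> = (\<integral>\<^sup>+z. ennreal (max 0 (h z)) \<partial>?P)"
    using h_int by (subst nn_integral_eq_integral) auto
  also have "\<dots> \<le> (\<integral>\<^sup>+z. ennreal (gas_weight g \<beta> n z) \<partial>?P)"
  proof (rule nn_integral_mono_AE)
    show "AE z in ?P. ennreal (max 0 (h z)) \<le> ennreal (gas_weight g \<beta> n z)"
      using inj
    proof eventually_elim
      case (elim z)
      have "1 + ?F - Q n z \<le> exp (?F - Q n z)"
        using exp_ge_add_one_self[of "?F - Q n z"] by linarith
      then have "h z \<le> exp (- ?F) * exp (?F - Q n z)"
        unfolding h_def by (intro mult_left_mono) auto
      also have "\<dots> = gas_weight g \<beta> n z"
        using gas_weight_eq_exp[OF elim] by (simp add: exp_add[symmetric])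
      finally show ?case
        using gas_weight_eq_exp[OF elim] by (intro ennreal_leI) simp
    qed
  qed
  also have "\<dots> = (\<integral>\<^sup>+z. ennreal (\<Prod>k<n. disc_density \<delta> (\<eta> k) (z k)) * ennreal (gas_weight g \<beta> n z) \<partial>?L)"
    unfolding PiM_disc_law[OF \<delta>(1)] by (rule nn_integral_density) measurable
  finally have le: "ennreal (exp (- ?F)) \<le> (\<integral>\<^sup>+z. ennreal (\<Prod>k<n. disc_density \<delta> (\<eta> k) (z k)) * ennreal (gas_weight g \<beta> n z) \<partial>?L)" .
  have "ennreal (?a * exp (- ?F)) = ennreal ?a * ennreal (exp (- ?F))"
    using \<delta> by (intro ennreal_mult) auto
  also have "\<dots> \<le> ennreal ?a * (\<integral>\<^sup>+z. ennreal (\<Prod>k<n. disc_density \<delta> (\<eta> k) (z k)) * ennreal (gas_weight g \<beta> n z) \<partial>?L)"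
    by (intro mult_left_mono le) simp
  also have "\<dots> = (\<integral>\<^sup>+z. ennreal ?a * (ennreal (\<Prod>k<n. disc_density \<delta> (\<eta> k) (z k)) * ennreal (gas_weight g \<beta> n z)) \<partial>?L)"
    by (rule nn_integral_cmult[symmetric]) measurable
  also have "\<dots> \<le> hole_partition_function g \<beta> U n"
    unfolding hole_partition_function_def
  proof (rule nn_integral_mono)
    fix z :: "nat \<Rightarrow> complex"
    have dens: "?a * (\<Prod>k<n. disc_density \<delta> (\<eta> k) (z k)) = (\<Prod>k<n. indicator (ball (\<eta> k) \<delta>) (z k))"
      using \<delta> by (simp add: disc_density_def prod_dividef)
    show "ennreal ?a * (ennreal (\<Prod>k<n. disc_density \<delta> (\<eta> k) (z k)) * ennreal (gas_weight g \<beta> n z))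
      \<le> ennreal (gas_weight g \<beta> n z) * indicator {z. \<forall>k<n. z k \<notin> U} z"
    proof (cases "\<forall>k<n. z k \<in> ball (\<eta> k) \<delta>")
      case True
      then have "\<forall>k<n. z k \<notin> U" using balls by blast
      moreover have "?a * (\<Prod>k<n. disc_density \<delta> (\<eta> k) (z k)) = 1" unfolding dens using True by simp
      then have "ennreal ?a * ennreal (\<Prod>k<n. disc_density \<delta> (\<eta> k) (z k)) = 1"
        using \<delta> by (subst ennreal_mult[symmetric]) (auto intro!: prod_nonneg simp: disc_density_nonneg)
      ultimately show ?thesis by (simp add: mult.assoc[symmetric])
    next
      case False
      then have zero: "(\<Prod>k<n. disc_density \<delta> (\<eta> k) (z k)) = 0"
        by (auto simp: disc_density_def indicator_def)
      show ?thesis unfolding zero by simp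
    qed
  qed
  finally show ?thesis .
qed

end

section \<open>Configurations of low energy\<close>

lemma emeasure_Compl_measure_support:
  assumes "sets \<mu> = sets borel"
  shows "emeasure \<mu> (- measure_support \<mu>) = 0"
proof -
  define F where "F = {B. \<exists>z e. B = ball (z::complex) e \<and> emeasure \<mu> B = 0}"
  have "\<And>B. B \<in> F \<Longrightarrow> open B" unfolding F_def by auto
  then obtain F' where F': "F' \<subseteq> F" "countable F'" "\<Union>F' = \<Union>F"
    using Lindelof by metis
  have "B \<in> null_sets \<mu>" if "B \<in> F'" for B
  proof (rule null_setsI)
    show "emeasure \<mu> B = 0" using that F' unfolding F_def by auto
    have "open B" using that F' unfolding F_def by auto
    then show "B \<in> sets \<mu>" unfolding assms by (rule borel_open)
  qed
  then have "\<Union>F' \<in> null_sets \<mu>"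
    using null_sets_UN'[OF F'(2), of "\<lambda>B. B" \<mu>] by simp
  moreover have "- measure_support \<mu> \<subseteq> \<Union>F'"
  proof
    fix z assume "z \<in> - measure_support \<mu>"
    then obtain e where "e > 0" "emeasure \<mu> (ball z e) = 0"
      unfolding measure_support_def by (auto simp: zero_less_iff_neq_zero)
    then have "ball z e \<in> F" "z \<in> ball z e" unfolding F_def by auto
    then show "z \<in> \<Union>F'" unfolding F'(3) by blast
  qed
  ultimately show ?thesis
    by (metis emeasure_eq_0 null_setsD1 null_setsD2)
qed

context gas_with_hole
begin

text \<open>
  For independent points with law \<open>\<mu>\<close>, the mean of the energy is \<open>\<beta> / 2 * n\<^sup>2\<close> times the energy
  of \<open>\<mu>\<close>, up to an error of order \<open>n\<close> from the missing diagonal terms. Hence some configuration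
  of distinct points in the support has at most this energy.
\<close>

lemma exists_configuration:
  assumes \<mu>: "\<mu> \<in> compact_prob_measures (- U)" and fin: "energy g \<beta> \<mu> < \<infinity>"
  shows "\<exists>e c. energy g \<beta> \<mu> = ereal e \<and>
    (\<forall>n. \<exists>z. inj_on z {..<n} \<and> (\<forall>k<n. z k \<notin> U) \<and> Q n z \<le> \<beta> / 2 * (real n)\<^sup>2 * e + real n * c)"
proof -
  have ps: "prob_space \<mu>" and sets [measurable_cong]: "sets \<mu> = sets borel"
    and comp: "compact (measure_support \<mu>)" and sub: "measure_support \<mu> \<subseteq> - U"
    using \<mu> unfolding compact_prob_measures_def by auto
  interpret prob_space \<mu> by fact
  interpret MM: pair_prob_space \<mu> \<mu> ..
  let ?M = "\<mu> \<Otimes>\<^sub>M \<mu>"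
  let ?S = "measure_support \<mu>"
  have ae_S: "AE z in \<mu>. z \<in> ?S"
  proof (rule AE_I)
    show "- ?S \<in> Sigma_Algebra.sets \<mu>"
      unfolding sets using comp by (intro borel_open open_Compl compact_imp_closed)
  qed (use emeasure_Compl_measure_support[OF sets] in auto)
  obtain R where R: "R > 0" "\<And>z. z \<in> ?S \<Longrightarrow> cmod z \<le> R"
    using compact_imp_bounded[OF comp] bounded_pos by metis
  have ae_R: "AE p in ?M. cmod (fst p) \<le> R \<and> cmod (snd p) \<le> R"
  proof (rule MM.AE_pair_measure)
    have "AE z in \<mu>. cmod z \<le> R" using ae_S by eventually_elim (rule R)
    then show "AE x in \<mu>. AE y in \<mu>. cmod (fst (x, y)) \<le> R \<and> cmod (snd (x, y)) \<le> R" by auto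
  qed measurable
  have int_g: "integrable \<mu> (\<lambda>z. g (cmod z))"
  proof (rule integrable_const_bound)
    show "AE z in \<mu>. norm (g (cmod z)) \<le> g R"
      using ae_S
    proof eventually_elim
      case (elim z)
      then have "g (cmod z) \<le> g R" using R g_mono by (auto simp: mono_on_def)
      then show ?case using g_nonneg[of "cmod z"] by simp
    qed
  qed measurable
  have [measurable]: "(\<lambda>p. log_kernel (fst p) (snd p)) \<in> borel_measurable (borel \<Otimes>\<^sub>M borel)"
    unfolding log_kernel_def by measurable
  define Pos where "Pos = (\<integral>\<^sup>+p. e2ennreal (log_kernel (fst p) (snd p)) \<partial>?M)"
  define Neg where "Neg = (\<integral>\<^sup>+p. e2ennreal (- log_kernel (fst p) (snd p)) \<partial>?M)"
  have "Neg \<le> (\<integral>\<^sup>+p. ennreal (\<bar>ln (2 * R)\<bar>) \<partial>?M)"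
    unfolding Neg_def
  proof (rule nn_integral_mono_AE)
    show "AE p in ?M. e2ennreal (- log_kernel (fst p) (snd p)) \<le> ennreal \<bar>ln (2 * R)\<bar>"
      using ae_R
    proof eventually_elim
      case (elim p)
      show ?case
      proof (cases "fst p = snd p")
        case False
        have "cmod (fst p - snd p) \<le> 2 * R"
          using elim norm_triangle_ineq4[of "fst p" "snd p"] by linarith
        then have "ln (cmod (fst p - snd p)) \<le> ln (2 * R)" using False by (intro ln_mono) auto
        then show ?thesis using False by (auto simp: log_kernel_eq_logk logk_def intro!: ennreal_leI)
      qed (simp add: log_kernel_def e2ennreal_neg)
    qed
  qed
  also have "\<dots> < \<infinity>" by (simp add: MM.emeasure_space_1)
  finally have Neg: "Neg < \<infinity>" .
  have en: "energy g \<beta> \<mu> = (enn2ereal Pos - enn2ereal Neg) + ereal (2 / \<beta> * (\<integral>z. g (cmod z) \<partial>\<mu>))"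
    unfolding energy_def ereal_integral_def Pos_def Neg_def case_prod_beta ..
  have Pos: "Pos < \<infinity>"
  proof (rule ccontr)
    assume "\<not> Pos < \<infinity>"
    then have "Pos = \<infinity>" by (simp add: less_top[symmetric])
    then show False using fin Neg unfolding en by (cases Neg) (auto simp: enn2ereal_ennreal)
  qed
  have ae_ne: "AE p in ?M. fst p \<noteq> snd p"
  proof -
    have "AE p in ?M. e2ennreal (log_kernel (fst p) (snd p)) \<noteq> \<infinity>"
      using Pos unfolding Pos_def by (intro nn_integral_PInf_AE) auto
    then show ?thesis by eventually_elim (auto simp: log_kernel_def)
  qed
  have int: "integrable ?M (\<lambda>p. logk (fst p) (snd p))"
    unfolding real_integrable_def
  proof (intro conjI)
    have "(\<integral>\<^sup>+p. ennreal (logk (fst p) (snd p)) \<partial>?M) = Pos"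
      unfolding Pos_def using ae_ne
      by (intro nn_integral_cong_AE) (auto elim!: eventually_mono simp: log_kernel_eq_logk)
    then show "(\<integral>\<^sup>+p. ennreal (logk (fst p) (snd p)) \<partial>?M) \<noteq> \<infinity>" using Pos by simp
    have "(\<integral>\<^sup>+p. ennreal (- logk (fst p) (snd p)) \<partial>?M) = Neg"
      unfolding Neg_def using ae_ne
      by (intro nn_integral_cong_AE) (auto elim!: eventually_mono simp: log_kernel_eq_logk)
    then show "(\<integral>\<^sup>+p. ennreal (- logk (fst p) (snd p)) \<partial>?M) \<noteq> \<infinity>" using Neg by simp
  qed measurable
  define I where "I = (\<integral>p. logk (fst p) (snd p) \<partial>?M)"
  define J where "J = (\<integral>z. g (cmod z) \<partial>\<mu>)"
  define e where "e = I + 2 / \<beta> * J"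
  have "energy g \<beta> \<mu> = ereal e"
    unfolding energy_def ereal_integral_log_kernel[OF ae_ne int] e_def I_def J_def by simp
  moreover have "\<exists>z. inj_on z {..<n} \<and> (\<forall>k<n. z k \<notin> U) \<and> Q n z \<le> \<beta> / 2 * (real n)\<^sup>2 * e + real n * (- \<beta> / 2 * I)" for n
  proof -
    let ?P = "PiM {..<n} (\<lambda>k. \<mu>)"
    interpret P: prob_space ?P by (rule prob_space_PiM) (rule ps)
    have iQ: "integrable ?P (Q n)"
      using ps int int_g by (intro integrable_gas_energy)
    have tri: "(\<Sum>j<m. real j) = real m * (real m - 1) / 2" for m :: nat
      by (induction m) (auto simp: field_simps)
    have "integral\<^sup>L ?P (Q n) = \<beta> * (\<Sum>j<n. \<Sum>i<j. I) + real n * (\<Sum>k<n. J)"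
      unfolding I_def J_def using ps int int_g by (intro integral_gas_energy)
    also have "\<dots> = \<beta> * (I * (\<Sum>j<n. real j)) + real n * (real n * J)"
      by (simp add: sum_distrib_left mult.commute)
    also have "\<dots> = \<beta> / 2 * (real n)\<^sup>2 * e + real n * (- \<beta> / 2 * I)"
      unfolding tri e_def using \<beta>_pos by (simp add: field_simps power2_eq_square)
    finally have EQ: "integral\<^sup>L ?P (Q n) = \<beta> / 2 * (real n)\<^sup>2 * e + real n * (- \<beta> / 2 * I)" .
    have inj: "AE z in ?P. inj_on z {..<n}"
      using ps ae_ne by (intro AE_PiM_inj_on)
    have "AE z in ?P. \<forall>k\<in>{..<n}. z k \<in> ?S"
      using ps ae_S by (intro AE_finite_allI) (auto intro!: AE_PiM_component)
    then have out: "AE z in ?P. \<forall>k<n. z k \<notin> U"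
      by eventually_elim (use sub in auto)
    show ?thesis
    proof (rule ccontr)
      assume no: "\<nexists>z. inj_on z {..<n} \<and> (\<forall>k<n. z k \<notin> U) \<and> Q n z \<le> \<beta> / 2 * (real n)\<^sup>2 * e + real n * (- \<beta> / 2 * I)"
      have "AE z in ?P. integral\<^sup>L ?P (Q n) < Q n z"
        using inj out by eventually_elim (use no in \<open>auto simp: EQ not_le\<close>)
      from P.expectation_greater[OF iQ this] show False by simp
    qed
  qed
  ultimately show ?thesis by blast
qed

section \<open>Asymptotics of the partition functions\<close>

lemma gas_weight_eq_0:
  assumes "\<not> inj_on z {..<n}"
  shows "gas_weight g \<beta> n z = 0"
proof -
  obtain i j where "i < n" "j < n" "i \<noteq> j" "z i = z j" using assms by (auto simp: inj_on_def)
  then obtain i j where ij: "i < j" "j < n" "z i = z j" by (metis linorder_neqE_nat)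
  then have "(\<Prod>i<j. cmod (z i - z j) powr \<beta>) = 0" by (intro prod_zero) (auto intro!: bexI[of _ i])
  then have "(\<Prod>j<n. \<Prod>i<j. cmod (z i - z j) powr \<beta>) = 0" using ij by (intro prod_zero) auto
  then show ?thesis unfolding gas_weight_def by (metis mult_zero_left)
qed

lemma nn_integral_exp_potential_finite: "(\<integral>\<^sup>+z. ennreal (exp (- g (cmod z))) \<partial>lborel) < \<infinity>"
proof -
  obtain C where C: "\<And>r. r \<ge> 0 \<Longrightarrow> real 4 * ln (1 + r) \<le> g r + C" using g_growth by metis
  \<comment> \<open>The plane is exhausted by discs with integral radii.\<close>
  have pointwise: "ennreal (exp (- g (cmod z)))
    \<le> (\<Sum>k. ennreal (exp C / (1 + real k) ^ 4) * indicator (ball (0::complex) (1 + real k)) z)" for z :: complex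
  proof -
    define k where "k = nat \<lfloor>cmod z\<rfloor>"
    have k: "real k \<le> cmod z" "cmod z < 1 + real k" unfolding k_def by (auto, linarith)
    have "- g (cmod z) \<le> C - real 4 * ln (1 + cmod z)" using C[of "cmod z"] by simp
    also have "\<dots> \<le> C - real 4 * ln (1 + real k)" using k by (intro diff_left_mono mult_left_mono ln_mono) auto
    finally have "exp (- g (cmod z)) \<le> exp (C - real 4 * ln (1 + real k))" by simp
    also have "\<dots> = exp C / (1 + real k) ^ 4"
      unfolding exp_diff exp_of_nat_mult by simp
    finally have "ennreal (exp (- g (cmod z))) \<le> ennreal (exp C / (1 + real k) ^ 4) * indicator (ball (0::complex) (1 + real k)) z"
      using k by (auto intro!: ennreal_leI)
    also have "\<dots> = (\<Sum>j\<in>{k}. ennreal (exp C / (1 + real j) ^ 4) * indicator (ball (0::complex) (1 + real j)) z)"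
      by (simp only: sum.insert sum.empty finite.emptyI empty_iff not_False_eq_True add_0_right)
    also have "\<dots> \<le> (\<Sum>j. ennreal (exp C / (1 + real j) ^ 4) * indicator (ball (0::complex) (1 + real j)) z)"
      by (rule sum_le_suminf) auto
    finally show ?thesis .
  qed
  have "(\<integral>\<^sup>+z. ennreal (exp (- g (cmod z))) \<partial>lborel)
    \<le> (\<integral>\<^sup>+z. (\<Sum>k. ennreal (exp C / (1 + real k) ^ 4) * indicator (ball (0::complex) (1 + real k)) z) \<partial>lborel)"
    by (intro nn_integral_mono pointwise)
  also have "\<dots> = (\<Sum>k. \<integral>\<^sup>+z. ennreal (exp C / (1 + real k) ^ 4) * indicator (ball (0::complex) (1 + real k)) z \<partial>lborel)"
    by (intro nn_integral_suminf) (auto intro!: borel_measurable_times borel_measurable_indicator)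
  also have "\<dots> = (\<Sum>k. ennreal (exp C * pi * inverse ((real (Suc k))\<^sup>2)))"
  proof (intro suminf_cong)
    fix k
    have "(\<integral>\<^sup>+z. ennreal (exp C / (1 + real k) ^ 4) * indicator (ball (0::complex) (1 + real k)) z \<partial>lborel)
      = ennreal (exp C / (1 + real k) ^ 4) * ennreal (pi * (1 + real k)\<^sup>2)"
      by (subst nn_integral_cmult_indicator) (auto simp: emeasure_ball_complex)
    also have "\<dots> = ennreal (exp C / (1 + real k) ^ 4 * (pi * (1 + real k)\<^sup>2))"
      by (intro ennreal_mult[symmetric]) auto
    also have "exp C / (1 + real k) ^ 4 * (pi * (1 + real k)\<^sup>2) = exp C * pi * inverse ((real (Suc k))\<^sup>2)"
    proof -
      have "u / x ^ 4 * (pi * x\<^sup>2) = u * pi * inverse (x\<^sup>2)" if "x \<noteq> 0" for u x :: real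
        using that by (simp add: field_simps power4_eq_xxxx power2_eq_square)
      from this[of "1 + real k" "exp C"] show ?thesis by simp
    qed
    finally show "(\<integral>\<^sup>+z. ennreal (exp C / (1 + real k) ^ 4) * indicator (ball (0::complex) (1 + real k)) z \<partial>lborel)
      = ennreal (exp C * pi * inverse ((real (Suc k))\<^sup>2))" .
  qed
  also have "\<dots> = ennreal (\<Sum>k. exp C * pi * inverse ((real (Suc k))\<^sup>2))"
  proof (rule suminf_ennreal2)
    have "summable (\<lambda>k. inverse ((real (Suc k))\<^sup>2))"
      using inverse_power_summable[of 2, where 'a = real] by (subst summable_Suc_iff) auto
    then show "summable (\<lambda>k. exp C * pi * inverse ((real (Suc k))\<^sup>2))" by (rule summable_mult)
  qed auto
  finally show ?thesis by (rule order_le_less_trans) simp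
qed

text \<open>
  The smeared empirical measure of one point bounds the minimal energy above; the configurations of
  low energy for an arbitrary measure, together with the lower bound for their energy, bound it below.
\<close>

lemma min_energy_real: "\<exists>R. min_energy g \<beta> U = ereal R"
proof -
  obtain e0 where e0: "min_energy g \<beta> U \<le> ereal e0"
  proof -
    have "ball (of_real (T + 1)) (1/2) \<subseteq> - U"
    proof
      fix x :: complex assume "x \<in> ball (of_real (T + 1)) (1/2)"
      then have "cmod (of_real (T + 1) - x) < 1/2" by (simp add: dist_norm)
      moreover have "cmod (of_real (T + 1) :: complex) = T + 1" 
        using T_pos norm_of_real[of "T + 1", where 'a = complex] by linarith
      ultimately have "cmod x > T" using norm_triangle_ineq2[of "of_real (T + 1)" x] by linarith
      then show "x \<in> - U" using U_subset by auto
    qed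
    then show thesis
      using smeared_measure_energy[of 1 "1/2" "\<lambda>_. of_real (T + 1)"] that by auto
  qed
  obtain C where C: "C \<ge> 0"
    "\<And>n z. real n * (\<Sum>k<n. g (cmod (z k))) / 2 - C * (real n)\<^sup>2 \<le> Q n z"
    using gas_energy_lower_bounds by (elim exE conjE) (rule that, auto)
  have "ereal (- (2 * C / \<beta>)) \<le> min_energy g \<beta> U"
    unfolding min_energy_def
  proof (rule INF_greatest)
    fix \<mu> assume \<mu>: "\<mu> \<in> compact_prob_measures (- U)"
    show "ereal (- (2 * C / \<beta>)) \<le> energy g \<beta> \<mu>"
    proof (cases "energy g \<beta> \<mu> < \<infinity>")
      case True
      obtain e c where e: "energy g \<beta> \<mu> = ereal e"
        "\<And>n. \<exists>z. inj_on z {..<n} \<and> (\<forall>k<n. z k \<notin> U) \<and> Q n z \<le> \<beta> / 2 * (real n)\<^sup>2 * e + real n * c"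
        using exists_configuration[OF \<mu> True] by blast
      have bound: "- C \<le> \<beta> / 2 * e + c / real n" if "n > 0" for n
      proof -
        obtain z where "Q n z \<le> \<beta> / 2 * (real n)\<^sup>2 * e + real n * c" using e(2) by blast
        moreover have "0 \<le> real n * (\<Sum>k<n. g (cmod (z k))) / 2"
          by (auto intro!: mult_nonneg_nonneg sum_nonneg g_nonneg)
        ultimately have "- C * (real n)\<^sup>2 \<le> \<beta> / 2 * (real n)\<^sup>2 * e + real n * c"
          using C(2)[of n z] by linarith
        also have "\<dots> = (\<beta> / 2 * e + c / real n) * (real n)\<^sup>2"
          using that by (simp add: distrib_right power2_eq_square)
        finally have "- C * (real n)\<^sup>2 \<le> (\<beta> / 2 * e + c / real n) * (real n)\<^sup>2" .
        then show ?thesis using that by (subst (asm) mult_le_cancel_right) auto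
      qed
      have "(\<lambda>n. \<beta> / 2 * e + c / real n) \<longlonglongrightarrow> \<beta> / 2 * e + 0"
        by (intro tendsto_add tendsto_const lim_const_over_n)
      moreover have "\<forall>\<^sub>F n in sequentially. - C \<le> \<beta> / 2 * e + c / real n"
        using eventually_gt_at_top[of 0] by eventually_elim (rule bound)
      ultimately have "- C \<le> \<beta> / 2 * e + 0"
        by (intro tendsto_lowerbound) auto
      then show ?thesis unfolding e(1) using \<beta>_pos by (simp add: field_simps)
    qed simp
  qed
  then show ?thesis using e0 by (cases "min_energy g \<beta> U") auto
qed

text \<open>
  The smeared empirical measure of every configuration outside the hole competes for the minimal
  energy, which bounds the energy of the configuration below. A share \<open>2 / n\<close> of the energy is
  kept aside and bounded below by the potential instead, so that the resulting bound for the weight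
  is integrable.
\<close>

lemma hole_partition_function_upper:
  assumes R: "min_energy g \<beta> U = ereal R"
  shows "\<exists>C\<ge>0. \<forall>\<kappa>>0. \<exists>b. \<forall>n\<ge>2. hole_partition_function g \<beta> U n \<le>
    ennreal (exp (- ((\<beta> / 2 * R - \<kappa> * C) / (1 + \<kappa>)) * (real n)\<^sup>2 + b * real n))"
proof -
  obtain C where C: "C \<ge> 0" "\<And>\<kappa>. \<kappa> > 0 \<Longrightarrow> \<exists>\<delta>. 0 < \<delta> \<and> \<delta> < 1 \<and>
    (\<forall>n z. inj_on z {..<n} \<longrightarrow> (\<forall>k<n. z k \<notin> U) \<longrightarrow>
      (\<exists>\<eta>. (\<forall>k<n. ball (\<eta> k) \<delta> \<subseteq> - U) \<and> smeared_energy \<delta> n \<eta> \<le> (1 + \<kappa>) * Q n z + \<kappa> * C * (real n)\<^sup>2))"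
    using smearing by (elim exE conjE) (rule that, auto)
  obtain D where D: "D \<ge> 0"
    "\<And>n z. real n * (\<Sum>k<n. g (cmod (z k))) / 2 - D * (real n)\<^sup>2 \<le> Q n z"
    using gas_energy_lower_bounds by (elim exE conjE) (rule that, auto)
  define J where "J = enn2real (\<integral>\<^sup>+z. ennreal (exp (- g (cmod z))) \<partial>lborel)"
  have J: "(\<integral>\<^sup>+z. ennreal (exp (- g (cmod z))) \<partial>lborel) = ennreal J" "J \<ge> 0"
    unfolding J_def using nn_integral_exp_potential_finite by auto
  have "\<exists>b. \<forall>n\<ge>2. hole_partition_function g \<beta> U n \<le>
      ennreal (exp (- ((\<beta> / 2 * R - \<kappa> * C) / (1 + \<kappa>)) * (real n)\<^sup>2 + b * real n))"
    if \<kappa>: "\<kappa> > 0" for \<kappa>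
  proof -
    obtain \<delta> where \<delta>: "0 < \<delta>" "\<delta> < 1" and sm: "\<And>n z. inj_on z {..<n} \<Longrightarrow> (\<forall>k<n. z k \<notin> U) \<Longrightarrow>
      \<exists>\<eta>. (\<forall>k<n. ball (\<eta> k) \<delta> \<subseteq> - U) \<and> smeared_energy \<delta> n \<eta> \<le> (1 + \<kappa>) * Q n z + \<kappa> * C * (real n)\<^sup>2"
      using C(2)[OF \<kappa>] by (elim exE conjE) (rule that, auto)
    define a where "a = (\<beta> / 2 * R - \<kappa> * C) / (1 + \<kappa>)"
    define c where "c = \<beta> / 2 * (ln (1 / \<delta>) + 2)"
    have "c \<ge> 0" unfolding c_def using \<delta> \<beta>_pos by (simp add: ln_ge_zero)
    have Q_ge: "a * (real n)\<^sup>2 - real n * c \<le> Q n z"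
      if n: "n > 0" and z: "inj_on z {..<n}" "\<forall>k<n. z k \<notin> U" for n z
    proof -
      obtain \<eta> where \<eta>: "\<forall>k<n. ball (\<eta> k) \<delta> \<subseteq> - U"
        "smeared_energy \<delta> n \<eta> \<le> (1 + \<kappa>) * Q n z + \<kappa> * C * (real n)\<^sup>2"
        using sm[OF z] by blast
      obtain e where e: "min_energy g \<beta> U \<le> ereal e"
        "\<beta> / 2 * (real n)\<^sup>2 * e \<le> smeared_energy \<delta> n \<eta> + real n * c"
        using smeared_measure_energy[OF n \<delta>, of \<eta>] \<eta>(1) unfolding c_def by auto
      have "\<beta> / 2 * (real n)\<^sup>2 * R \<le> \<beta> / 2 * (real n)\<^sup>2 * e"
        using e(1) \<beta>_pos unfolding R by (intro mult_left_mono) auto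
      then have "(\<beta> / 2 * R - \<kappa> * C) * (real n)\<^sup>2 - real n * c \<le> (1 + \<kappa>) * Q n z"
        using e(2) \<eta>(2) by (simp add: algebra_simps)
      moreover have "(1 + \<kappa>) * (a * (real n)\<^sup>2 - real n * c) = (\<beta> / 2 * R - \<kappa> * C) * (real n)\<^sup>2 - real n * c - \<kappa> * (real n * c)"
        unfolding a_def using \<kappa> by (simp add: field_simps)
      moreover have "\<kappa> * (real n * c) \<ge> 0" using \<kappa> \<open>c \<ge> 0\<close> by simp
      ultimately have "(1 + \<kappa>) * (a * (real n)\<^sup>2 - real n * c) \<le> (1 + \<kappa>) * Q n z" by linarith
      then show ?thesis using \<kappa> by (subst (asm) mult_le_cancel_left_pos) auto
    qed
    define b where "b = 2 * \<bar>a\<bar> + c + 2 * D"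
    have Q_ge': "a * (real n)\<^sup>2 - b * real n + (\<Sum>k<n. g (cmod (z k))) \<le> Q n z"
      if n: "n \<ge> 2" and z: "inj_on z {..<n}" "\<forall>k<n. z k \<notin> U" for n z
    proof -
      \<comment> \<open>The share \<open>t\<close> makes the lower bound by half of the potential term exactly the total potential.\<close>
      define t where "t = 2 / real n"
      have t: "0 \<le> t" "t \<le> 1" "t * real n = 2" using n by (auto simp: t_def)
      have "(1 - t) * (a * (real n)\<^sup>2 - real n * c) \<le> (1 - t) * Q n z"
        using Q_ge[OF _ z] n t by (intro mult_left_mono) auto
      moreover have "t * (real n * (\<Sum>k<n. g (cmod (z k))) / 2 - D * (real n)\<^sup>2) \<le> t * Q n z"
        using D(2) t by (intro mult_left_mono) auto
      ultimately have "(1 - t) * (a * (real n)\<^sup>2 - real n * c) + t * (real n * (\<Sum>k<n. g (cmod (z k))) / 2 - D * (real n)\<^sup>2) \<le> Q n z"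
        by (simp add: algebra_simps)
      moreover have "(1 - t) * (a * (real n)\<^sup>2 - real n * c) = a * (real n)\<^sup>2 - (t * real n) * a * real n - real n * c + (t * real n) * c"
        by (simp add: algebra_simps power2_eq_square)
      moreover have "t * (real n * (\<Sum>k<n. g (cmod (z k))) / 2 - D * (real n)\<^sup>2)
        = (t * real n) * (\<Sum>k<n. g (cmod (z k))) / 2 - (t * real n) * D * real n"
        by (simp add: algebra_simps power2_eq_square)
      ultimately have "a * (real n)\<^sup>2 - 2 * a * real n - real n * c + 2 * c + (\<Sum>k<n. g (cmod (z k))) - 2 * D * real n \<le> Q n z"
        unfolding t(3) by simp
      moreover have "a * real n \<le> \<bar>a\<bar> * real n" by (intro mult_right_mono) auto
      ultimately show ?thesis unfolding b_def using \<open>c \<ge> 0\<close> by (simp add: algebra_simps)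
    qed
    have "hole_partition_function g \<beta> U n \<le> ennreal (exp (- a * (real n)\<^sup>2 + (b + ln (1 + J)) * real n))"
      if n: "n \<ge> 2" for n
    proof -
      interpret L: product_sigma_finite "\<lambda>_::nat. lborel :: complex measure"
        by standard
      let ?E = "exp (- a * (real n)\<^sup>2 + b * real n)"
      have "hole_partition_function g \<beta> U n
        \<le> (\<integral>\<^sup>+z. ennreal ?E * (\<Prod>k<n. ennreal (exp (- g (cmod (z k))))) \<partial>(\<Pi>\<^sub>M k\<in>{..<n}. lborel))"
        unfolding hole_partition_function_def
      proof (rule nn_integral_mono)
        fix z :: "nat \<Rightarrow> complex"
        show "ennreal (gas_weight g \<beta> n z) * indicator {z. \<forall>k<n. z k \<notin> U} z
          \<le> ennreal ?E * (\<Prod>k<n. ennreal (exp (- g (cmod (z k)))))"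
        proof (cases "inj_on z {..<n} \<and> (\<forall>k<n. z k \<notin> U)")
          case True
          then have "gas_weight g \<beta> n z \<le> exp (- a * (real n)\<^sup>2 + b * real n + - (\<Sum>k<n. g (cmod (z k))))"
            using Q_ge'[OF n, of z] by (simp add: gas_weight_eq_exp)
          also have "\<dots> = ?E * (\<Prod>k<n. exp (- g (cmod (z k))))"
            unfolding exp_add[of "- a * (real n)\<^sup>2 + b * real n"] by (simp add: exp_sum[symmetric] sum_negf)
          finally have "ennreal (gas_weight g \<beta> n z) \<le> ennreal (?E * (\<Prod>k<n. exp (- g (cmod (z k)))))"
            by (rule ennreal_leI)
          also have "\<dots> = ennreal ?E * (\<Prod>k<n. ennreal (exp (- g (cmod (z k)))))"
            by (simp add: ennreal_mult prod_nonneg prod_ennreal)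
          finally show ?thesis using True by simp
        next
          case False
          then have zero: "ennreal (gas_weight g \<beta> n z) * indicator {z. \<forall>k<n. z k \<notin> U} z = 0"
            using gas_weight_eq_0[of z n] by (auto simp: indicator_def)
          show ?thesis unfolding zero by simp
        qed
      qed
      also have "\<dots> = ennreal ?E * (\<integral>\<^sup>+z. (\<Prod>k<n. ennreal (exp (- g (cmod (z k))))) \<partial>(\<Pi>\<^sub>M k\<in>{..<n}. lborel))"
      proof (rule nn_integral_cmult)
        have "(\<lambda>z. ennreal (exp (- g (cmod (z k))))) \<in> borel_measurable (\<Pi>\<^sub>M k\<in>{..<n}. (lborel :: complex measure))"
          if [simp]: "k < n" for k
          by (rule measurable_compose[of "\<lambda>z. z k" _ borel "\<lambda>w. ennreal (exp (- g (cmod w)))"]) measurable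
        then show "(\<lambda>z. \<Prod>k<n. ennreal (exp (- g (cmod (z k))))) \<in> borel_measurable (\<Pi>\<^sub>M k\<in>{..<n}. (lborel :: complex measure))"
          by (intro borel_measurable_prod_ennreal) auto
      qed
      also have "(\<integral>\<^sup>+z. (\<Prod>k<n. ennreal (exp (- g (cmod (z k))))) \<partial>(\<Pi>\<^sub>M k\<in>{..<n}. lborel)) = (\<Prod>k<n. ennreal J)"
        by (subst L.product_nn_integral_prod[where f = "\<lambda>_ w. ennreal (exp (- g (cmod w)))"]) (simp_all add: J(1))
      also have "\<dots> \<le> ennreal (1 + J) ^ n"
        using J(2) by (simp, intro power_mono ennreal_leI) auto
      also have "ennreal (1 + J) ^ n = ennreal (exp (ln (1 + J) * real n))"
        using J(2) by (subst ennreal_power) (auto simp: exp_of_nat2_mult add_pos_nonneg)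
      also have "ennreal ?E * \<dots> = ennreal (exp (- a * (real n)\<^sup>2 + (b + ln (1 + J)) * real n))"
        by (subst ennreal_mult[symmetric]) (auto simp: exp_add[symmetric] algebra_simps)
      finally show ?thesis by (simp add: mult_left_mono)
    qed
    then show ?thesis unfolding a_def by blast
  qed
  then show ?thesis using C(1) by blast
qed

text \<open>
  A configuration of low energy is smeared over discs outside the hole, and the partition function is
  bounded below on the product of these discs.
\<close>

lemma hole_partition_function_lower:
  "\<exists>C\<ge>0. \<forall>\<kappa>>0. \<forall>\<mu>\<in>compact_prob_measures (- U). \<forall>e. energy g \<beta> \<mu> = ereal e \<longrightarrow> (\<exists>b. \<forall>n.
    ennreal (exp (- ((1 + \<kappa>) * (\<beta> / 2 * e) + \<kappa> * C) * (real n)\<^sup>2 + b * real n)) \<le> hole_partition_function g \<beta> U n)"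
proof -
  obtain C where C: "C \<ge> 0" "\<And>\<kappa>. \<kappa> > 0 \<Longrightarrow> \<exists>\<delta>. 0 < \<delta> \<and> \<delta> < 1 \<and>
    (\<forall>n z. inj_on z {..<n} \<longrightarrow> (\<forall>k<n. z k \<notin> U) \<longrightarrow>
      (\<exists>\<eta>. (\<forall>k<n. ball (\<eta> k) \<delta> \<subseteq> - U) \<and> smeared_energy \<delta> n \<eta> \<le> (1 + \<kappa>) * Q n z + \<kappa> * C * (real n)\<^sup>2))"
    using smearing by (elim exE conjE) (rule that, auto)
  have "\<exists>b. \<forall>n. ennreal (exp (- ((1 + \<kappa>) * (\<beta> / 2 * e) + \<kappa> * C) * (real n)\<^sup>2 + b * real n)) \<le> hole_partition_function g \<beta> U n"
    if \<kappa>: "\<kappa> > 0" and \<mu>: "\<mu> \<in> compact_prob_measures (- U)" and e: "energy g \<beta> \<mu> = ereal e" for \<kappa> \<mu> e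
  proof -
    obtain \<delta> where \<delta>: "0 < \<delta>" "\<delta> < 1" and sm: "\<And>n z. inj_on z {..<n} \<Longrightarrow> (\<forall>k<n. z k \<notin> U) \<Longrightarrow>
      \<exists>\<eta>. (\<forall>k<n. ball (\<eta> k) \<delta> \<subseteq> - U) \<and> smeared_energy \<delta> n \<eta> \<le> (1 + \<kappa>) * Q n z + \<kappa> * C * (real n)\<^sup>2"
      using C(2)[OF \<kappa>] by (elim exE conjE) (rule that, auto)
    obtain c where c: "\<And>n. \<exists>z. inj_on z {..<n} \<and> (\<forall>k<n. z k \<notin> U) \<and> Q n z \<le> \<beta> / 2 * (real n)\<^sup>2 * e + real n * c"
      using exists_configuration[OF \<mu>] e by auto
    define b where "b = ln (pi * \<delta>\<^sup>2) - (1 + \<kappa>) * c"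
    have "ennreal (exp (- ((1 + \<kappa>) * (\<beta> / 2 * e) + \<kappa> * C) * (real n)\<^sup>2 + b * real n)) \<le> hole_partition_function g \<beta> U n" for n
    proof -
      obtain z where z: "inj_on z {..<n}" "\<forall>k<n. z k \<notin> U" "Q n z \<le> \<beta> / 2 * (real n)\<^sup>2 * e + real n * c"
        using c by blast
      obtain \<eta> where \<eta>: "\<forall>k<n. ball (\<eta> k) \<delta> \<subseteq> - U"
        "smeared_energy \<delta> n \<eta> \<le> (1 + \<kappa>) * Q n z + \<kappa> * C * (real n)\<^sup>2"
        using sm[OF z(1,2)] by blast
      have "(1 + \<kappa>) * Q n z \<le> (1 + \<kappa>) * (\<beta> / 2 * (real n)\<^sup>2 * e + real n * c)"
        using z(3) \<kappa> by (intro mult_left_mono) auto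
      then have "- ((1 + \<kappa>) * (\<beta> / 2 * e) + \<kappa> * C) * (real n)\<^sup>2 + b * real n
        \<le> ln (pi * \<delta>\<^sup>2) * real n + - smeared_energy \<delta> n \<eta>"
        using \<eta>(2) unfolding b_def by (simp add: algebra_simps)
      then have "exp (- ((1 + \<kappa>) * (\<beta> / 2 * e) + \<kappa> * C) * (real n)\<^sup>2 + b * real n)
        \<le> exp (ln (pi * \<delta>\<^sup>2) * real n + - smeared_energy \<delta> n \<eta>)" by simp
      also have "\<dots> = (pi * \<delta>\<^sup>2) ^ n * exp (- smeared_energy \<delta> n \<eta>)"
        unfolding exp_add using \<delta> by (simp add: exp_of_nat2_mult)
      finally show ?thesis
        using hole_partition_function_ge[OF \<delta>, of n \<eta>] \<eta>(1) by (auto intro: order_trans ennreal_leI)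
    qed
    then show ?thesis by blast
  qed
  then show ?thesis using C(1) by blast
qed

lemma hole_partition_function_limit:
  assumes R: "min_energy g \<beta> U = ereal R"
  shows "\<forall>\<^sub>F n in sequentially. 0 < hole_partition_function g \<beta> U n \<and> hole_partition_function g \<beta> U n < \<infinity>"
    and "(\<lambda>n. ln (enn2real (hole_partition_function g \<beta> U n)) / (real n)\<^sup>2) \<longlonglongrightarrow> - (\<beta> / 2 * R)"
proof -
  let ?Z = "hole_partition_function g \<beta> U"
  let ?x = "\<lambda>n. ln (enn2real (?Z n)) / (real n)\<^sup>2"
  obtain C1 where C1: "\<And>\<kappa>. \<kappa> > 0 \<Longrightarrow> \<exists>b. \<forall>n\<ge>2. ?Z n \<le>
    ennreal (exp (- ((\<beta> / 2 * R - \<kappa> * C1) / (1 + \<kappa>)) * (real n)\<^sup>2 + b * real n))"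
    using hole_partition_function_upper[OF R] by blast
  obtain C2 where lower: "\<forall>\<kappa>>0. \<forall>\<mu>\<in>compact_prob_measures (- U). \<forall>e. energy g \<beta> \<mu> = ereal e \<longrightarrow> (\<exists>b. \<forall>n.
    ennreal (exp (- ((1 + \<kappa>) * (\<beta> / 2 * e) + \<kappa> * C2) * (real n)\<^sup>2 + b * real n)) \<le> ?Z n)"
    using hole_partition_function_lower by (elim exE conjE) (rule that)
  note C2 = lower[rule_format]
  have approx: "\<exists>\<mu>\<in>compact_prob_measures (- U). \<exists>e. energy g \<beta> \<mu> = ereal e \<and> e < R + \<epsilon>" if "\<epsilon> > 0" for \<epsilon>
  proof -
    have "min_energy g \<beta> U < ereal (R + \<epsilon>)" using R that by simp
    then obtain \<mu> where \<mu>: "\<mu> \<in> compact_prob_measures (- U)" "energy g \<beta> \<mu> < ereal (R + \<epsilon>)"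
      unfolding min_energy_def INF_less_iff by blast
    have "min_energy g \<beta> U \<le> energy g \<beta> \<mu>" unfolding min_energy_def by (rule INF_lower[OF \<mu>(1)])
    then show ?thesis using \<mu> R by (cases "energy g \<beta> \<mu>") auto
  qed
  obtain b1 where b1: "\<And>n. n \<ge> 2 \<Longrightarrow> ?Z n \<le> ennreal (exp (- ((\<beta> / 2 * R - 1 * C1) / (1 + 1)) * (real n)\<^sup>2 + b1 * real n))"
    using C1[of 1] by auto
  have fin: "?Z n < \<infinity>" if "n \<ge> 2" for n
    using b1[OF that] by (rule order_le_less_trans) simp
  obtain \<mu>1 e1 where "\<mu>1 \<in> compact_prob_measures (- U)" "energy g \<beta> \<mu>1 = ereal e1"
    using approx[of 1] by auto
  from C2[OF _ this, of 1] obtain b2 where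
    b2: "\<And>n. ennreal (exp (- ((1 + 1) * (\<beta> / 2 * e1) + 1 * C2) * (real n)\<^sup>2 + b2 * real n)) \<le> ?Z n" by auto
  have pos: "?Z n > 0" for n
    by (rule less_le_trans[OF _ b2]) simp
  show "\<forall>\<^sub>F n in sequentially. 0 < ?Z n \<and> ?Z n < \<infinity>"
    using eventually_ge_at_top[of 2] by eventually_elim (use pos fin in auto)
  have Z_real: "?Z n = ennreal (enn2real (?Z n))" "enn2real (?Z n) > 0" if "n \<ge> 2" for n
    using pos[of n] fin[OF that] by (auto simp: enn2real_positive_iff)
  have quad: "(\<lambda>n. (- A * (real n)\<^sup>2 + b * real n) / (real n)\<^sup>2) \<longlonglongrightarrow> - A" for A b
  proof -
    have "(\<lambda>n. - A + b / real n) \<longlonglongrightarrow> - A + 0"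
      by (intro tendsto_add tendsto_const lim_const_over_n)
    moreover have "\<forall>\<^sub>F n in sequentially. - A + b / real n = (- A * (real n)\<^sup>2 + b * real n) / (real n)\<^sup>2"
      using eventually_gt_at_top[of 0] by eventually_elim (simp add: field_simps power2_eq_square)
    ultimately show ?thesis by (simp add: filterlim_cong[OF refl refl])
  qed
  show "?x \<longlonglongrightarrow> - (\<beta> / 2 * R)"
  proof (rule order_tendstoI)
    fix y assume y: "y < - (\<beta> / 2 * R)"
    define \<epsilon> where "\<epsilon> = (- (\<beta> / 2 * R) - y) / \<beta>"
    have "\<epsilon> > 0" using y \<beta>_pos by (simp add: \<epsilon>_def)
    then obtain \<mu> e where \<mu>: "\<mu> \<in> compact_prob_measures (- U)" "energy g \<beta> \<mu> = ereal e" "e < R + \<epsilon>"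
      using approx by blast
    have "\<beta> / 2 * e < \<beta> / 2 * (R + \<epsilon>)" using \<mu>(3) \<beta>_pos by (intro mult_strict_left_mono) auto
    also have "\<dots> = (\<beta> / 2 * R - y) / 2"
      using \<beta>_pos by (simp add: \<epsilon>_def field_simps)
    also have "\<dots> < - y" using y by (simp add: field_simps)
    finally have e_lt: "\<beta> / 2 * e < - y" .
    have "((\<lambda>\<kappa>. (1 + \<kappa>) * (\<beta> / 2 * e) + \<kappa> * C2) \<longlongrightarrow> (1 + 0) * (\<beta> / 2 * e) + 0 * C2) (at_right 0)"
      by (intro tendsto_intros)
    then have "\<forall>\<^sub>F \<kappa> in at_right 0. (1 + \<kappa>) * (\<beta> / 2 * e) + \<kappa> * C2 < - y"
      using e_lt by (intro order_tendstoD) auto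
    then have "\<forall>\<^sub>F \<kappa> in at_right 0. \<kappa> > 0 \<and> (1 + \<kappa>) * (\<beta> / 2 * e) + \<kappa> * C2 < - y"
      using eventually_at_right_less by eventually_elim auto
    then obtain \<kappa> where \<kappa>: "\<kappa> > 0" "(1 + \<kappa>) * (\<beta> / 2 * e) + \<kappa> * C2 < - y"
      using eventually_happens'[OF trivial_limit_at_right_real] by blast
    obtain b where b: "\<And>n. ennreal (exp (- ((1 + \<kappa>) * (\<beta> / 2 * e) + \<kappa> * C2) * (real n)\<^sup>2 + b * real n)) \<le> ?Z n"
      using C2[OF \<kappa>(1) \<mu>(1,2)] by blast
    have "\<forall>\<^sub>F n in sequentially. y < (- ((1 + \<kappa>) * (\<beta> / 2 * e) + \<kappa> * C2) * (real n)\<^sup>2 + b * real n) / (real n)\<^sup>2"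
      using \<kappa>(2) by (intro order_tendstoD(1)[OF quad]) simp
    then show "\<forall>\<^sub>F n in sequentially. y < ?x n"
      using eventually_ge_at_top[of 2]
    proof eventually_elim
      case (elim n)
      have "exp (- ((1 + \<kappa>) * (\<beta> / 2 * e) + \<kappa> * C2) * (real n)\<^sup>2 + b * real n) \<le> enn2real (?Z n)"
        using enn2real_mono[OF b[of n]] fin[OF elim(2)] by simp
      then have "- ((1 + \<kappa>) * (\<beta> / 2 * e) + \<kappa> * C2) * (real n)\<^sup>2 + b * real n \<le> ln (enn2real (?Z n))"
        using Z_real(2)[OF elim(2)] by (subst ln_ge_iff) auto
      then show ?case by (intro less_le_trans[OF elim(1)] divide_right_mono) auto
    qed
  next
    fix y assume y: "- (\<beta> / 2 * R) < y"
    have "((\<lambda>\<kappa>. (\<beta> / 2 * R - \<kappa> * C1) / (1 + \<kappa>)) \<longlongrightarrow> (\<beta> / 2 * R - 0 * C1) / (1 + 0)) (at_right 0)"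
      by (intro tendsto_intros) auto
    then have "\<forall>\<^sub>F \<kappa> in at_right 0. - y < (\<beta> / 2 * R - \<kappa> * C1) / (1 + \<kappa>)"
      using y by (intro order_tendstoD) auto
    then have "\<forall>\<^sub>F \<kappa> in at_right 0. \<kappa> > 0 \<and> - y < (\<beta> / 2 * R - \<kappa> * C1) / (1 + \<kappa>)"
      using eventually_at_right_less by eventually_elim auto
    then obtain \<kappa> where \<kappa>: "\<kappa> > 0" "- y < (\<beta> / 2 * R - \<kappa> * C1) / (1 + \<kappa>)"
      using eventually_happens'[OF trivial_limit_at_right_real] by blast
    obtain b where b: "\<And>n. n \<ge> 2 \<Longrightarrow> ?Z n \<le> ennreal (exp (- ((\<beta> / 2 * R - \<kappa> * C1) / (1 + \<kappa>)) * (real n)\<^sup>2 + b * real n))"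
      using C1[OF \<kappa>(1)] by blast
    have "\<forall>\<^sub>F n in sequentially. (- ((\<beta> / 2 * R - \<kappa> * C1) / (1 + \<kappa>)) * (real n)\<^sup>2 + b * real n) / (real n)\<^sup>2 < y"
      using \<kappa>(2) by (intro order_tendstoD(2)[OF quad]) simp
    then show "\<forall>\<^sub>F n in sequentially. ?x n < y"
      using eventually_ge_at_top[of 2]
    proof eventually_elim
      case (elim n)
      have "enn2real (?Z n) \<le> exp (- ((\<beta> / 2 * R - \<kappa> * C1) / (1 + \<kappa>)) * (real n)\<^sup>2 + b * real n)"
        using b[OF elim(2)] by (intro enn2real_leI) auto
      then have "ln (enn2real (?Z n)) \<le> ln (exp (- ((\<beta> / 2 * R - \<kappa> * C1) / (1 + \<kappa>)) * (real n)\<^sup>2 + b * real n))"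
        using Z_real(2)[OF elim(2)] by (rule ln_mono)
      then have "ln (enn2real (?Z n)) \<le> - ((\<beta> / 2 * R - \<kappa> * C1) / (1 + \<kappa>)) * (real n)\<^sup>2 + b * real n"
        by (simp only: ln_exp)
      then show ?case by (intro le_less_trans[OF _ elim(1)] divide_right_mono) auto
    qed
  qed
qed

lemma gas_law_hole_probability:
  assumes "hole_partition_function g \<beta> {} n < \<infinity>" and "hole_partition_function g \<beta> {} n > 0"
  shows "\<P>(z in gas_law g \<beta> n. num_points n z U = 0)
    = enn2real (hole_partition_function g \<beta> U n) / enn2real (hole_partition_function g \<beta> {} n)"
proof -
  let ?L = "\<Pi>\<^sub>M k\<in>{..<n}. (lborel :: complex measure)"
  let ?Z = "gas_partition_function g \<beta> n"
  have Z: "hole_partition_function g \<beta> {} n = ?Z"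
    unfolding hole_partition_function_def gas_partition_function_def by simp
  define A where "A = {z \<in> space ?L. \<forall>k\<in>{..<n}. z k \<notin> U}"
  have A [measurable]: "A \<in> sets ?L"
    unfolding A_def
  proof (rule sets.sets_Collect_finite_All)
    fix k assume "k \<in> {..<n}"
    have "(\<lambda>z. z k) -` (- U) \<inter> space ?L \<in> sets ?L"
      using \<open>k \<in> {..<n}\<close> open_U by (intro measurable_sets[of _ _ "lborel"] measurable_component_singleton) auto
    also have "(\<lambda>z. z k) -` (- U) \<inter> space ?L = {z \<in> space ?L. z k \<notin> U}" by auto
    finally show "{z \<in> space ?L. z k \<notin> U} \<in> sets ?L" .
  qed simp
  have set_eq: "{z \<in> space (gas_law g \<beta> n). num_points n z U = 0} = A"
    unfolding gas_law_def A_def num_points_def by (auto simp: card_eq_0_iff)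
  have "emeasure (gas_law g \<beta> n) A = (\<integral>\<^sup>+z. ennreal (gas_weight g \<beta> n z) / ?Z * indicator A z \<partial>?L)"
    unfolding gas_law_def by (rule emeasure_density) measurable
  also have "\<dots> = (\<integral>\<^sup>+z. (ennreal (gas_weight g \<beta> n z) * indicator {z. \<forall>k<n. z k \<notin> U} z) / ?Z \<partial>?L)"
    by (intro nn_integral_cong) (auto simp: A_def indicator_def)
  also have "\<dots> = (\<integral>\<^sup>+z. (ennreal (gas_weight g \<beta> n z) * indicator A z) / ?Z \<partial>?L)"
    by (intro nn_integral_cong) (auto simp: A_def indicator_def)
  also have "\<dots> = (\<integral>\<^sup>+z. ennreal (gas_weight g \<beta> n z) * indicator A z \<partial>?L) / ?Z"
    by (rule nn_integral_divide) measurable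
  also have "(\<integral>\<^sup>+z. ennreal (gas_weight g \<beta> n z) * indicator A z \<partial>?L) = hole_partition_function g \<beta> U n"
    unfolding hole_partition_function_def by (intro nn_integral_cong) (auto simp: A_def indicator_def)
  finally have em: "emeasure (gas_law g \<beta> n) A = hole_partition_function g \<beta> U n / ?Z" .
  have le: "hole_partition_function g \<beta> U n \<le> ?Z"
    unfolding hole_partition_function_def gas_partition_function_def
    by (intro nn_integral_mono) (auto simp: indicator_def)
  have fin: "hole_partition_function g \<beta> U n < \<infinity>" using le assms(1) unfolding Z by (rule order_le_less_trans)
  obtain p where p: "hole_partition_function g \<beta> U n = ennreal p" "p \<ge> 0"
    using fin by (cases "hole_partition_function g \<beta> U n") auto
  obtain q where q: "?Z = ennreal q" "q > 0"
    using assms unfolding Z by (cases ?Z) (auto simp: less_top)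
  show ?thesis
    unfolding set_eq measure_def em Z p(1) q(1) using p q by (simp add: divide_ennreal)
qed

end

section \<open>Hole probabilities\<close>

theorem theorem5p3:
  fixes g g' :: "real \<Rightarrow> real" and \<beta> T :: real and U :: "complex set"
  assumes "admissible_potential g"
    and "\<beta> > 0"
    and "T > 0" and "T * deriv g T = \<beta>"
    and "\<And>r. r \<in> {0..T + 1} \<Longrightarrow> (g has_real_derivative g' r) (at r within {0..})"
    and "bounded (g' ` {0..T + 1})"
    and "open U" and "U \<subseteq> ball 0 T"
    and "exterior_ball_condition U"
  shows "(\<lambda>n. ereal (1 / (real n)\<^sup>2 * ln (\<P>(z in gas_law g \<beta> n. num_points n z U = 0))))
           \<longlonglongrightarrow> - ereal (\<beta> / 2) * (min_energy g \<beta> U - min_energy g \<beta> {})"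
proof -
  have adm: "\<And>r. r \<ge> 0 \<Longrightarrow> g r \<ge> 0" "mono_on {0..} g" "g differentiable_on {0<..}"
    using assms(1) unfolding admissible_potential_def by auto
  have cont: "continuous_on {0..} g"
    unfolding continuous_on_eq_continuous_within
  proof
    fix r :: real assume "r \<in> {0..}"
    show "continuous (at r within {0..}) g"
    proof (cases "r \<le> T + 1")
      case True
      then show ?thesis using assms(5)[of r] \<open>r \<in> {0..}\<close> by (intro DERIV_continuous) simp_all
    next
      case False
      then have "r \<in> {0<..}" using \<open>T > 0\<close> by simp
      then have "continuous_on {0<..} g" "r \<in> {0<..}"
        using adm(3) by (auto intro: differentiable_imp_continuous_on)
      then have "isCont g r" by (metis continuous_on_eq_continuous_at open_greaterThan)
      then show ?thesis by (rule continuous_at_imp_continuous_at_within)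
    qed
  qed
  interpret H: gas_with_hole g \<beta> T U
    by (rule gas_with_hole.intro[OF adm(1,2) cont potential_growth[OF assms(1)] assms(2,3,7,8,9)])
  have ext: "exterior_ball_condition {}"
    unfolding exterior_ball_condition_def by (intro exI[of _ 1]) simp
  interpret E: gas_with_hole g \<beta> T "{}"
    by (rule gas_with_hole.intro[OF adm(1,2) cont potential_growth[OF assms(1)] assms(2,3) open_empty empty_subsetI ext])
  obtain R where R: "min_energy g \<beta> U = ereal R" using H.min_energy_real by blast
  obtain R0 where R0: "min_energy g \<beta> {} = ereal R0" using E.min_energy_real by blast
  let ?ZU = "hole_partition_function g \<beta> U" and ?Z = "hole_partition_function g \<beta> {}"
  have "(\<lambda>n. ln (enn2real (?ZU n)) / (real n)\<^sup>2 - ln (enn2real (?Z n)) / (real n)\<^sup>2) \<longlonglongrightarrow> - (\<beta> / 2 * R) - - (\<beta> / 2 * R0)"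
    by (intro tendsto_diff H.hole_partition_function_limit(2)[OF R] E.hole_partition_function_limit(2)[OF R0])
  moreover have "\<forall>\<^sub>F n in sequentially. ln (enn2real (?ZU n)) / (real n)\<^sup>2 - ln (enn2real (?Z n)) / (real n)\<^sup>2
    = 1 / (real n)\<^sup>2 * ln (\<P>(z in gas_law g \<beta> n. num_points n z U = 0))"
    using H.hole_partition_function_limit(1)[OF R] E.hole_partition_function_limit(1)[OF R0]
  proof eventually_elim
    case (elim n)
    then have "enn2real (?ZU n) > 0" "enn2real (?Z n) > 0" by (auto simp: enn2real_positive_iff)
    then have "ln (enn2real (?ZU n) / enn2real (?Z n)) = ln (enn2real (?ZU n)) - ln (enn2real (?Z n))"
      by (simp add: ln_div)
    moreover have "\<P>(z in gas_law g \<beta> n. num_points n z U = 0) = enn2real (?ZU n) / enn2real (?Z n)"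
      using elim by (intro H.gas_law_hole_probability) auto
    ultimately show ?case by (simp add: diff_divide_distrib)
  qed
  ultimately have "(\<lambda>n. 1 / (real n)\<^sup>2 * ln (\<P>(z in gas_law g \<beta> n. num_points n z U = 0)))
      \<longlonglongrightarrow> - (\<beta> / 2 * R) - - (\<beta> / 2 * R0)"
    by (rule Lim_transform_eventually)
  then have "(\<lambda>n. ereal (1 / (real n)\<^sup>2 * ln (\<P>(z in gas_law g \<beta> n. num_points n z U = 0))))
      \<longlonglongrightarrow> ereal (- (\<beta> / 2 * R) - - (\<beta> / 2 * R0))"
    by (rule tendsto_ereal)
  also have "ereal (- (\<beta> / 2 * R) - - (\<beta> / 2 * R0)) = - ereal (\<beta> / 2) * (min_energy g \<beta> U - min_energy g \<beta> {})"
    unfolding R R0 by (simp add: field_simps)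
  finally show ?thesis .
qed

end
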